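(* Let $\mathbf{Q}=\mathbf{Q}^\top\in\mathbb{R}^{d\times d}$ be positive definite, $\mathbf{q}\in\mathbb{R}^d$, and $\mathbf{y}^*=-\mathbf{Q}^{-1}\mathbf{q}$. Consider the distributed gradient descent flow with Poisson-distributed communication events with zero channel drift rates (i.e. $a_{(j,i)}(t)\equiv 0$ for all channels $(j,i)$): for $i\in\{1,\dots,n\}$ and $j\in\{1,\dots,n\}\setminus\{i\}$, $$d\mathbf{x}_i(t)=-\Big(\mathbf{Q}_{ii}\mathbf{x}_i(t)+\sum_{j\neq i}\mathbf{Q}_{ij}\mathbf{z}_{(j,i)}(t)+\mathbf{q}_i\Big)\,dt,\qquad d\mathbf{z}_{(j,i)}(t)=\big(\mathbf{x}_j(t)-\mathbf{z}_{(j,i)}(t)\big)\,dN_{(j,i)}(t),$$ where the $N_{(j,i)}$ are independent Poisson processes with rates $\lambda_{(j,i)}$. Then: (a) There exists a constant communication rate $\lambda_{\mathrm{s}}\in[0,\infty)$ such that, whenever $\lambda_{(j,i)}\in(\lambda_{\mathrm{s}},\infty)$ for all pairs $(j,i)$ with $j\neq i$, the state $(\mathbf{x}^*,\mathbf{z}^* )$ is globally uniformly exponentially stable in the mean-square sense for this system (ultimate bound $\gamma=0$). (b) For every $\beta\in(0,2\lambda_{\min}(\mathbf{Q}))$ there exists a constant communication rate $\lambda_{\mathrm{d}}\in[\lambda_{\mathrm{s}},\infty)$ (with $\lambda_{\mathrm{s}}$ as in (a)) such that, whenever $\lambda_{(j,i)}\in(\lambda_{\mathrm{d}},\infty)$ for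 all pairs $(j,i)$ with $j\neq i$, the state $(\mathbf{x}^*,\mathbf{z}^* )$ is globally uniformly exponentially stable in the mean-square sense for this system (ultimate bound $\gamma=0$) with exponential convergence rate $\beta$.
   Context: **Problem and partition.** The underlying problem is $\min_{\mathbf{y}\in\mathbb{R}^d} J(\mathbf{y})=\tfrac12\mathbf{y}^\top\mathbf{Q}\mathbf{y}+\mathbf{q}^\top\mathbf{y}$ with $\mathbf{Q}$ symmetric positive definite; its unique minimizer is $\mathbf{y}^*=-\mathbf{Q}^{-1}\mathbf{q}$. There are $n$ agents. Vectors in $\mathbb{R}^d$ are partitioned into $n$ sub-vectors of dimensions $d_1,\dots,d_n$ with $d_1+\dots+d_n=d$; $\mathbf{Q}$ and $\mathbf{q}$ are partitioned accordingly into blocks $\mathbf{Q}_{ij}\in\mathbb{R}^{d_i\times d_j}$ and $\mathbf{q}_i\in\mathbb{R}^{d_i}$, and $\mathbf{y}^*$ into $\mathbf{y}^*_i\in\mathbb{R}^{d_i}$. $\lambda_{\min}(\mathbf{Q})$ denotes the smallest eigenvalue of $\mathbf{Q}$. **States.** $\mathbf{x}_i(t)\in\mathbb{R}^{d_i}$ is the state of agent $i$; $\mathbf{z}_{(j,i)}(t)\in\mathbb{R}^{d_j}$ is agent $i$'s local copy of agent $j$'s state. The full state is $(\mathbf{x},\mathbf{z})$, where $\mathbf{x}$ stacks all $\mathbf{x}_i$ and $\mathbf{z}$ stacks all $\mathbf{z}_{(j,i)}$ with $j\ne i$. The reference state $(\mathbf{x}^*,\mathbf{z}^* )$ is given by $\mathbf{x}^*=\mathbf{y}^*$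 and $\mathbf{z}^*=\mathrm{vec}(\mathbf{y}^*_{-1},\dots,\mathbf{y}^*_{-n})$, where $\mathbf{y}^*_{-i}$ is $\mathbf{y}^*$ with its $i$-th block removed; i.e. the component of $\mathbf{z}^*$ corresponding to $\mathbf{z}_{(j,i)}$ is $\mathbf{y}^*_j$. **Meaning of the SDE.** On a complete filtered probability space satisfying the usual conditions, solutions are adapted càdlàg processes satisfying the corresponding integral equations: between jump times the state follows the deterministic ODE given by the $dt$-terms, and at each jump time $\tau$ of $N_{(j,i)}$ the jump coefficient is evaluated at left limits, so $\mathbf{z}_{(j,i)}(\tau)=\mathbf{x}_j(\tau^-)$. **Stability notion.** Let $t_0$ be the initial time and $\|\cdot\|$ the Euclidean norm. A point $\mathbf{s}^*$ in the state space is *globally uniformly exponentially stable in the mean-square sense* for a Poisson jump-driven SDE with state $\mathbf{s}$ if there exist constants $\alpha,\beta\in(0,\infty)$ such that for every (deterministic) initial condition $\mathbf{s}(t_0)=\mathbf{s}^0$, $$\mathbb{E}\big[\|\mathbf{s}(t)-\mathbf{s}^*\|^2\big]\le\alpha\,\|\mathbf{s}^0-\mathbf{s}^*\|^2e^{-\beta(t-t_0)}\qquad\text{for all }t\in[t_0,\infty).$$ (The "practical" version of this notion allows an additional constant $\gamma\ge0$, the ultimate bound, on the right-hand side; here $\gamma=0$.) "With exponential convergence rate $\beta$" means that the inequality holds with this given value of $\beta$. Here $\mathbf{s}=(\mathbf{x},\mathbf{z})$ and $\mathbf{s}^*=(\mathbf{x}^*,\mathbf{z}^* )$. *)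

theory Defs
  imports "HOL-Probability.Probability"
begin

section \<open>Filtered probability spaces and Poisson processes\<close>

text \<open>
  The time index of the filtration is the whole real line; a filtration indexed by
  \<open>{t0..}\<close> is extended by \<open>F t = F t0\<close> for \<open>t < t0\<close>.
\<close>

locale usual_filtered_prob_space =
  prob_space M + complete_measure M + filtration "space M" F
  for M :: "'a measure" and F :: "real \<Rightarrow> 'a measure" +
  assumes sets_F_subset: "sets (F t) \<subseteq> sets M"
    and null_sets_F: "null_sets M \<subseteq> sets (F t)"
    and right_continuous_F: "sets (F t) = (\<Inter>u\<in>{t<..}. sets (F u))"

definition cadlag_from :: "real \<Rightarrow> (real \<Rightarrow> 'b::topological_space) \<Rightarrow> bool" where
  "cadlag_from t0 f \<longleftrightarrow>
     (\<forall>t\<ge>t0. (f \<longlongrightarrow> f t) (at_right t)) \<and> (\<forall>t>t0. \<exists>l. (f \<longlongrightarrow> l) (at_left t))"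

definition left_limit :: "(real \<Rightarrow> 'b::t2_space) \<Rightarrow> real \<Rightarrow> 'b" where
  "left_limit f t = Lim (at_left t) f"

definition counting_path :: "real \<Rightarrow> (real \<Rightarrow> nat) \<Rightarrow> bool" where
  "counting_path t0 N \<longleftrightarrow> N t0 = 0 \<and> mono_on {t0..} N \<and> cadlag_from t0 N \<and>
     (\<forall>t>t0. N t \<le> left_limit N t + 1)"

definition jump_times :: "real \<Rightarrow> (real \<Rightarrow> nat) \<Rightarrow> real \<Rightarrow> real set" where
  "jump_times t0 N t = {\<tau>. t0 < \<tau> \<and> \<tau> \<le> t \<and> N \<tau> \<noteq> left_limit N \<tau>}"

text \<open>
  A finite family of independent Poisson processes relative to \<open>F\<close>, with rates \<open>r\<close>.
  The last conjunct says that, for the family as a whole, increments after time \<open>s\<close> are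
  independent of the history \<open>F s\<close>.  (For mutually independent processes which are
  individually Poisson relative to \<open>F\<close> this holds by Watanabe's characterization.)
\<close>

definition independent_poisson_processes ::
  "'a measure \<Rightarrow> (real \<Rightarrow> 'a measure) \<Rightarrow> real \<Rightarrow> 'c set \<Rightarrow> ('c \<Rightarrow> real) \<Rightarrow>
    ('c \<Rightarrow> real \<Rightarrow> 'a \<Rightarrow> nat) \<Rightarrow> bool" where
  "independent_poisson_processes M F t0 C r N \<longleftrightarrow>
     (\<forall>c\<in>C. \<forall>t\<ge>t0. N c t \<in> measurable (F t) (count_space UNIV)) \<and>
     (\<forall>c\<in>C. AE \<omega> in M. counting_path t0 (\<lambda>t. N c t \<omega>)) \<and>
     (\<forall>c\<in>C. \<forall>s\<ge>t0. \<forall>u>s.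
        distr M (count_space UNIV) (\<lambda>\<omega>. N c u \<omega> - N c s \<omega>)
          = measure_pmf (poisson_pmf (r c * (u - s)))) \<and>
     prob_space.indep_vars M (\<lambda>_. PiM {t0..} (\<lambda>_. count_space UNIV))
       (\<lambda>c \<omega>. \<lambda>t\<in>{t0..}. N c t \<omega>) C \<and>
     (\<forall>s\<ge>t0. \<forall>u>s.
        prob_space.indep_set M (sets (F s))
          (sets (vimage_algebra (space M) (\<lambda>\<omega>. \<lambda>c\<in>C. N c u \<omega> - N c s \<omega>)
            (PiM C (\<lambda>_. count_space UNIV)))))"

section \<open>Mean-square exponential stability\<close>

text \<open>
  \<open>sol s0 s\<close> is meant as: the process \<open>s\<close> solves the equation with initial condition
  \<open>s t0 = s0\<close>.  The expectation is a nonnegative integral, so that the bound includes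
  finiteness of the second moment.
\<close>

definition ms_exp_stable_with_rate ::
  "'a measure \<Rightarrow> real \<Rightarrow> ('s::real_normed_vector \<Rightarrow> (real \<Rightarrow> 'a \<Rightarrow> 's) \<Rightarrow> bool) \<Rightarrow> 's \<Rightarrow>
    real \<Rightarrow> bool" where
  "ms_exp_stable_with_rate M t0 sol sstar \<beta> \<longleftrightarrow>
     (\<exists>\<alpha>>0. \<forall>s0 s. sol s0 s \<longrightarrow> (\<forall>t\<ge>t0.
        (\<integral>\<^sup>+\<omega>. ennreal ((norm (s t \<omega> - sstar))\<^sup>2) \<partial>M)
          \<le> ennreal (\<alpha> * (norm (s0 - sstar))\<^sup>2 * exp (- \<beta> * (t - t0)))))"

definition ms_exp_stable ::
  "'a measure \<Rightarrow> real \<Rightarrow> ('s::real_normed_vector \<Rightarrow> (real \<Rightarrow> 'a \<Rightarrow> 's) \<Rightarrow> bool) \<Rightarrow> 's \<Rightarrow>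
    bool" where
  "ms_exp_stable M t0 sol sstar \<longleftrightarrow> (\<exists>\<beta>>0. ms_exp_stable_with_rate M t0 sol sstar \<beta>)"

section \<open>Partitioned quadratic problem\<close>

definition positive_definite :: "real^'d^'d \<Rightarrow> bool" where
  "positive_definite Q \<longleftrightarrow> (\<forall>v. v \<noteq> 0 \<longrightarrow> 0 < v \<bullet> (Q *v v))"

definition eigenvalues :: "real^'d^'d \<Rightarrow> real set" where
  "eigenvalues Q = {e. \<exists>v. v \<noteq> 0 \<and> Q *v v = e *\<^sub>R v}"

definition lambda_min :: "real^'d^'d \<Rightarrow> real" where
  "lambda_min Q = Min (eigenvalues Q)"

text \<open>
  The partition is given by a map \<open>b\<close> that assigns to each coordinate the agent owning it,
  so \<open>d\<^sub>i = card {k. b k = i}\<close>.  Since the \<open>d\<^sub>i\<close> may differ, sub-vectors and blocks are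
  represented in the full space, padded with zeros outside the block.
\<close>

definition subvec :: "('d \<Rightarrow> 'n) \<Rightarrow> 'n \<Rightarrow> real^'d \<Rightarrow> real^'d" where
  "subvec b i v = (\<chi> k. if b k = i then v $ k else 0)"

definition submat :: "('d \<Rightarrow> 'n) \<Rightarrow> 'n \<Rightarrow> 'n \<Rightarrow> real^'d^'d \<Rightarrow> real^'d^'d" where
  "submat b i j Q = (\<chi> k l. if b k = i \<and> b l = j then Q $ k $ l else 0)"

section \<open>Distributed gradient flow with Poisson communication\<close>

text \<open>
  A state is a pair \<open>(x, z)\<close> where \<open>subvec b i x\<close> is the state of agent \<open>i\<close> and, for
  \<open>j \<noteq> i\<close>, \<open>subvec b j (z $ i)\<close> is agent \<open>i\<close>'s copy of the state of agent \<open>j\<close>, written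
  \<open>z\<^sub>(\<^sub>j\<^sub>,\<^sub>i\<^sub>)\<close>.  Agents keep no copy of their own state: those coordinates of \<open>z\<close> are fixed
  to zero, hence the norm of the product type is the Euclidean norm of the stacked state.
\<close>

definition state_space :: "('d \<Rightarrow> 'n) \<Rightarrow> ((real^'d) \<times> (real^'d^'n)) set" where
  "state_space b = {(x, z). \<forall>i. subvec b i (z $ i) = 0}"

definition reference_state :: "('d \<Rightarrow> 'n) \<Rightarrow> real^'d \<Rightarrow> (real^'d) \<times> (real^'d^'n)" where
  "reference_state b y = (y, \<chi> i. y - subvec b i y)"

definition channels :: "('n \<times> 'n) set" where
  "channels = {(j, i). j \<noteq> i}"

text \<open>
  Pathwise integral equations.  As the paths of \<open>N (j, i)\<close> increase by unit jumps, the
  integral with respect to \<open>N (j, i)\<close> of the left limits is a finite sum over jump times.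
\<close>

definition flow_path ::
  "('d::finite \<Rightarrow> 'n::finite) \<Rightarrow> real^'d^'d \<Rightarrow> real^'d \<Rightarrow> real \<Rightarrow> ('n \<times> 'n \<Rightarrow> real \<Rightarrow> nat) \<Rightarrow>
    (real \<Rightarrow> real^'d) \<Rightarrow> (real \<Rightarrow> real^'d^'n) \<Rightarrow> bool" where
  "flow_path b Q q t0 N x z \<longleftrightarrow>
     (\<forall>i. \<forall>t\<ge>t0.
        ((\<lambda>s. - (submat b i i Q *v subvec b i (x s)
                 + (\<Sum>j\<in>UNIV - {i}. submat b i j Q *v subvec b j (z s $ i))
                 + subvec b i q))
          has_integral (subvec b i (x t) - subvec b i (x t0))) {t0..t}) \<and>
     (\<forall>(j, i)\<in>channels. \<forall>t\<ge>t0.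
        subvec b j (z t $ i) = subvec b j (z t0 $ i)
          + (\<Sum>\<tau>\<in>jump_times t0 (N (j, i)) t.
               subvec b j (left_limit x \<tau>) - subvec b j (left_limit z \<tau> $ i)))"

definition flow_solution ::
  "'a measure \<Rightarrow> (real \<Rightarrow> 'a measure) \<Rightarrow> ('d::finite \<Rightarrow> 'n::finite) \<Rightarrow> real^'d^'d \<Rightarrow> real^'d \<Rightarrow>
    real \<Rightarrow> ('n \<times> 'n \<Rightarrow> real \<Rightarrow> 'a \<Rightarrow> nat) \<Rightarrow>
    (real^'d) \<times> (real^'d^'n) \<Rightarrow> (real \<Rightarrow> 'a \<Rightarrow> (real^'d) \<times> (real^'d^'n)) \<Rightarrow> bool" where
  "flow_solution M F b Q q t0 N s0 s \<longleftrightarrow>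
     s0 \<in> state_space b \<and>
     (\<forall>t\<ge>t0. s t \<in> borel_measurable (F t)) \<and>
     (AE \<omega> in M.
        s t0 \<omega> = s0 \<and>
        (\<forall>t\<ge>t0. s t \<omega> \<in> state_space b) \<and>
        cadlag_from t0 (\<lambda>t. s t \<omega>) \<and>
        flow_path b Q q t0 (\<lambda>c t. N c t \<omega>) (\<lambda>t. fst (s t \<omega>)) (\<lambda>t. snd (s t \<omega>)))"

end

theory Submission
  imports Defs
begin

text \<open>
  Put \<open>X = x - y\<^sup>*\<close> and let \<open>E\<close> collect the errors \<open>z\<^sub>(\<^sub>j\<^sub>,\<^sub>i\<^sub>) - x\<^sub>j\<close> of the local copies. With
  \<open>V = |X|\<^sup>2 + |E|\<^sup>2\<close> the drift contributes at most \<open>- \<beta>' V + \<mu> |E|\<^sup>2\<close> for every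
  \<open>\<beta>' < 2 \<lambda>\<^sub>m\<^sub>i\<^sub>n\<close>, where \<open>\<mu>\<close> depends on \<open>\<beta>'\<close> and \<open>Q\<close> only, and a jump of a channel resets its
  error, so that communication contributes \<open>- \<lambda> |E|\<^sup>2\<close>. Instead of the generator of the
  process, a discretisation is used: over a time step \<open>h\<close> the paths satisfy the
  corresponding inequality up to \<open>O(h\<^sup>2) V\<close>, plus \<open>O(h) V\<close> on the event, of probability
  \<open>O(h)\<close> and independent of the past, that some channel jumps. Taking expectations gives
  \<open>m(t + h) \<le> exp (- \<beta> h) m(t)\<close> for the mean \<open>m\<close> of \<open>V\<close>, \<open>\<beta> < \<beta>'\<close> and small \<open>h\<close>, and this
  is iterated.
\<close>

section \<open>The smallest eigenvalue\<close>

lemma positive_definite_imp_ker_trivial: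
  assumes "positive_definite (Q :: real^'d^'d)" "Q *v v = 0"
  shows "v = 0"
  using assms unfolding positive_definite_def by force

lemma symmetric_inner_matrix:
  fixes Q :: "real^'d^'d"
  assumes "transpose Q = Q"
  shows "(Q *v v) \<bullet> w = v \<bullet> (Q *v w)"
  by (metis assms dot_lmul_matrix transpose_matrix_vector)

text \<open>Choosing one eigenvector per eigenvalue maps the spectrum injectively onto pairwise
  orthogonal vectors, of which there are only finitely many. Finiteness is what gives the
  \<open>Min\<close> in \<open>lambda_min\<close> its meaning.\<close>

lemma finite_eigenvalues:
  fixes Q :: "real^'d^'d"
  assumes sym: "transpose Q = Q"
  shows "finite (eigenvalues Q)"
proof -
  define ev where "ev e = (SOME v. v \<noteq> 0 \<and> Q *v v = e *\<^sub>R v)" for e :: real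
  have ev: "ev e \<noteq> 0 \<and> Q *v ev e = e *\<^sub>R ev e" if "e \<in> eigenvalues Q" for e
    using that unfolding eigenvalues_def ev_def mem_Collect_eq by (rule someI_ex)
  have orth: "ev e \<bullet> ev f = 0" if "e \<in> eigenvalues Q" "f \<in> eigenvalues Q" "e \<noteq> f" for e f
  proof -
    have "e * (ev e \<bullet> ev f) = f * (ev e \<bullet> ev f)"
      using symmetric_inner_matrix[OF sym, of "ev e" "ev f"] ev[OF that(1)] ev[OF that(2)] by simp
    then show ?thesis using that(3) by simp
  qed
  have "pairwise orthogonal (ev ` eigenvalues Q)"
    using orth by (auto simp: pairwise_def orthogonal_def)
  then have "finite (ev ` eigenvalues Q)"
    by (rule pairwise_orthogonal_imp_finite)
  moreover have "inj_on ev (eigenvalues Q)"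
    using orth ev by (metis inj_onI inner_eq_zero_iff)
  ultimately show ?thesis
    using finite_imageD by blast
qed

text \<open>A minimiser of the Rayleigh quotient on the unit sphere is an eigenvector, because the
  nonnegative quadratic form \<open>v \<bullet> Q v - m (v \<bullet> v)\<close> vanishes there and hence has zero gradient.\<close>

lemma lambda_min_properties:
  fixes Q :: "real^'d^'d"
  assumes sym: "transpose Q = Q"
  shows lambda_min_le_quadratic_form: "lambda_min Q * (norm v)\<^sup>2 \<le> v \<bullet> (Q *v v)"
    and lambda_min_in_eigenvalues: "lambda_min Q \<in> eigenvalues Q"
proof -
  let ?S = "sphere (0::real^'d) 1"
  have "?S \<noteq> {}"
    by (simp add: sphere_eq_empty)
  moreover have "continuous_on ?S (\<lambda>v. v \<bullet> (Q *v v))"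
    by (intro continuous_intros linear_continuous_on matrix_vector_mul_bounded_linear)
  ultimately obtain w where w: "w \<in> ?S" and wmin: "\<And>v. v \<in> ?S \<Longrightarrow> w \<bullet> (Q *v w) \<le> v \<bullet> (Q *v v)"
    using continuous_attains_inf[of ?S "\<lambda>v. v \<bullet> (Q *v v)"] by auto
  define m where "m = w \<bullet> (Q *v w)"
  have ray: "m * (norm v)\<^sup>2 \<le> v \<bullet> (Q *v v)" for v
  proof (cases "v = 0")
    case False
    define u where "u = (1 / norm v) *\<^sub>R v"
    have "m \<le> u \<bullet> (Q *v u)"
      unfolding m_def by (rule wmin) (simp add: u_def False)
    also have "\<dots> = (v \<bullet> (Q *v v)) / (norm v)\<^sup>2"
      by (simp add: u_def power2_eq_square matrix_vector_mult_scaleR)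
    finally show ?thesis
      using False by (simp add: pos_le_divide_eq)
  qed simp
  define r where "r = Q *v w - m *\<^sub>R w"
  have quad: "0 \<le> 2 * \<epsilon> * (r \<bullet> r) + \<epsilon>\<^sup>2 * (r \<bullet> (Q *v r) - m * (r \<bullet> r))" for \<epsilon>
  proof -
    have ww: "w \<bullet> w = 1"
      using w by (simp add: dot_square_norm)
    have sw: "w \<bullet> (Q *v r) = r \<bullet> (Q *v w)"
      using symmetric_inner_matrix[OF sym, of w r] by (simp add: inner_commute)
    have rr: "r \<bullet> r = r \<bullet> (Q *v w) - m * (r \<bullet> w)"
      by (simp add: r_def inner_diff_right)
    have "0 \<le> (w + \<epsilon> *\<^sub>R r) \<bullet> (Q *v (w + \<epsilon> *\<^sub>R r)) - m * ((w + \<epsilon> *\<^sub>R r) \<bullet> (w + \<epsilon> *\<^sub>R r))"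
      using ray[of "w + \<epsilon> *\<^sub>R r"] by (simp add: dot_square_norm)
    also have "\<dots> = 2 * \<epsilon> * (r \<bullet> r) + \<epsilon>\<^sup>2 * (r \<bullet> (Q *v r) - m * (r \<bullet> r))"
      by (simp add: matrix_vector_right_distrib matrix_vector_mult_scaleR inner_add_left
          inner_add_right sw rr ww inner_commute[of w r] m_def[symmetric])
        (simp add: algebra_simps power2_eq_square)
    finally show ?thesis .
  qed
  have "r \<bullet> r = 0"
  proof (rule ccontr)
    assume "r \<bullet> r \<noteq> 0"
    then have rp: "r \<bullet> r > 0" by simp
    define B where "B = r \<bullet> (Q *v r) - m * (r \<bullet> r)"
    have B: "0 \<le> B"
      using ray[of r] by (simp add: B_def dot_square_norm)
    \<comment> \<open>A step against the residual \<open>r\<close>, short enough that the negative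
      linear term of \<open>quad\<close> outweighs the quadratic one. The summand \<open>1\<close>
      keeps the denominator positive when \<open>B = 0\<close>.\<close>
    define \<epsilon> where "\<epsilon> = - (r \<bullet> r) / (B + 1)"
    have "\<epsilon>\<^sup>2 * B \<le> (r \<bullet> r)\<^sup>2 / (B + 1)"
      using B by (simp add: \<epsilon>_def power_divide divide_simps power2_eq_square)
        (simp add: mult_left_mono)
    moreover have "2 * \<epsilon> * (r \<bullet> r) = - 2 * ((r \<bullet> r)\<^sup>2 / (B + 1))"
      by (simp add: \<epsilon>_def power2_eq_square)
    moreover have "(r \<bullet> r)\<^sup>2 / (B + 1) > 0"
      using rp B by simp
    ultimately show False
      using quad[of \<epsilon>] by (simp add: B_def)
  qed
  then have "m \<in> eigenvalues Q"
    using w by (auto simp: eigenvalues_def r_def intro!: exI[of _ w])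
  moreover have "m \<le> e" if "e \<in> eigenvalues Q" for e
  proof -
    obtain v where v: "v \<noteq> 0" "Q *v v = e *\<^sub>R v"
      using \<open>e \<in> _\<close> by (auto simp: eigenvalues_def)
    have "m * (norm v)\<^sup>2 \<le> e * (norm v)\<^sup>2"
      using ray[of v] v(2) by (simp add: dot_square_norm)
    then show ?thesis using v(1) by simp
  qed
  ultimately have m: "lambda_min Q = m"
    unfolding lambda_min_def by (intro Min_eqI finite_eigenvalues sym) auto
  show "lambda_min Q * (norm v)\<^sup>2 \<le> v \<bullet> (Q *v v)"
    using ray by (simp add: m)
  show "lambda_min Q \<in> eigenvalues Q"
    using \<open>m \<in> _\<close> by (simp add: m)
qed

lemma lambda_min_pos:
  fixes Q :: "real^'d^'d"
  assumes "transpose Q = Q" "positive_definite Q"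
  shows "0 < lambda_min Q"
proof -
  obtain v where v: "v \<noteq> 0" "Q *v v = lambda_min Q *\<^sub>R v"
    using lambda_min_in_eigenvalues[OF assms(1)] by (auto simp: eigenvalues_def)
  have "0 < lambda_min Q * (v \<bullet> v)"
    using assms(2) v unfolding positive_definite_def by fastforce
  then show ?thesis
    by (rule zero_less_mult_pos2) (use v(1) in simp)
qed

text \<open>Stationarity of the minimiser. The reference point enters the later estimates only
  through this equation.\<close>

lemma positive_definite_minimiser:
  fixes Q :: "real^'d^'d"
  assumes "positive_definite Q"
  shows "Q *v (- (matrix_inv Q *v q)) = - q"
proof -
  have "invertible Q"
    using positive_definite_imp_ker_trivial[OF assms]
    by (auto simp: invertible_left_inverse matrix_left_invertible_ker)
  then have "Q ** matrix_inv Q = mat 1"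
    unfolding invertible_def matrix_inv_def by (rule someI_ex[THEN conjunct1])
  then have "Q *v (matrix_inv Q *v q) = q"
    by (simp add: matrix_vector_mul_assoc)
  then show ?thesis
    by (metis matrix_vector_mult_diff_distrib diff_0 mult_zero_right matrix_vector_mult_0_right)
qed

section \<open>Counting paths\<close>

lemma eventually_at_left_interval:
  fixes \<tau> s :: real
  assumes "s < \<tau>" "\<And>r. s < r \<Longrightarrow> r < \<tau> \<Longrightarrow> P r"
  shows "eventually P (at_left \<tau>)"
  using assms by (auto simp: eventually_at_left intro!: exI[of _ s])

lemma left_limit_eqI:
  fixes f :: "real \<Rightarrow> 'b::t2_space"
  assumes "(f \<longlongrightarrow> l) (at_left t)"
  shows "left_limit f t = l"
  using assms unfolding left_limit_def by (intro tendsto_Lim) auto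

lemma tendsto_left_limit:
  fixes f :: "real \<Rightarrow> 'b::t2_space"
  assumes "cadlag_from t0 f" "t0 < t"
  shows "(f \<longlongrightarrow> left_limit f t) (at_left t)"
proof -
  obtain l where l: "(f \<longlongrightarrow> l) (at_left t)"
    using assms unfolding cadlag_from_def by blast
  then show ?thesis
    using left_limit_eqI[OF l] by simp
qed

section \<open>Jump times and increments of one counting path\<close>

context
  fixes t0 :: real and N :: "real \<Rightarrow> nat"
  assumes N: "counting_path t0 N"
begin

lemma counting_path_mono: "t0 \<le> s \<Longrightarrow> s \<le> r \<Longrightarrow> N s \<le> N r"
  using N by (auto simp: counting_path_def intro: mono_onD)

lemma counting_path_eventually_left:
  assumes "t0 < \<tau>"
  shows "eventually (\<lambda>r. N r = left_limit N \<tau>) (at_left \<tau>)"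
  using tendsto_left_limit[of t0 N \<tau>] N assms
  by (auto simp: counting_path_def tendsto_discrete)

lemma counting_path_eventually_right:
  assumes "t0 \<le> \<tau>"
  shows "eventually (\<lambda>r. N r = N \<tau>) (at_right \<tau>)"
  using N assms by (auto simp: counting_path_def cadlag_from_def tendsto_discrete)

lemma counting_path_le_left_limit:
  assumes "t0 \<le> s" "s < \<tau>"
  shows "N s \<le> left_limit N \<tau>"
proof -
  have "eventually (\<lambda>r. N s \<le> N r) (at_left \<tau>)"
    using assms by (intro eventually_at_left_interval[of s]) (auto intro: counting_path_mono)
  moreover have "eventually (\<lambda>r. N r = left_limit N \<tau>) (at_left \<tau>)"
    using assms by (intro counting_path_eventually_left) auto
  ultimately have "eventually (\<lambda>r. N s \<le> left_limit N \<tau>) (at_left \<tau>)"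
    by eventually_elim simp
  then show ?thesis by simp
qed

lemma left_limit_le_counting_path:
  assumes "t0 < \<tau>"
  shows "left_limit N \<tau> \<le> N \<tau>"
proof -
  have "eventually (\<lambda>r. N r \<le> N \<tau>) (at_left \<tau>)"
    using assms by (intro eventually_at_left_interval[of t0]) (auto intro: counting_path_mono)
  with counting_path_eventually_left[OF assms]
  have "eventually (\<lambda>r. left_limit N \<tau> \<le> N \<tau>) (at_left \<tau>)"
    by eventually_elim simp
  then show ?thesis by simp
qed

text \<open>The path strictly increases from one jump time to the next, so \<open>N\<close> injects
  the jump times up to \<open>t\<close> into \<open>{..N t}\<close>. On an infinite set the sum in
  \<open>flow_path\<close> would be \<open>0\<close> by convention.\<close>

lemma finite_jump_times: "finite (jump_times t0 N t)"
proof -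
  have less: "N \<sigma> < N \<tau>"
    if "\<sigma> \<in> jump_times t0 N t" "\<tau> \<in> jump_times t0 N t" "\<sigma> < \<tau>" for \<sigma> \<tau>
  proof -
    have "N \<sigma> \<le> left_limit N \<tau>"
      using that by (intro counting_path_le_left_limit) (auto simp: jump_times_def)
    also have "\<dots> < N \<tau>"
      using that left_limit_le_counting_path[of \<tau>] by (auto simp: jump_times_def)
    finally show ?thesis .
  qed
  have "inj_on N (jump_times t0 N t)"
    using less by (intro linorder_inj_onI') (metis nat_neq_iff)
  moreover have "N ` jump_times t0 N t \<subseteq> {..N t}"
    by (auto simp: jump_times_def intro: counting_path_mono)
  ultimately show ?thesis
    using finite_imageD finite_subset by blast
qed

text \<open>Links the two descriptions of a communication event: the integral equation speaks of
  jump times, the Poisson law of increments. A jump in \<open>(s, u]\<close> strictly raises the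
  path; conversely, a path that changes must do so at a jump time.\<close>

lemma jump_times_eq_iff:
  assumes "t0 \<le> s" "s \<le> u"
  shows "jump_times t0 N u = jump_times t0 N s \<longleftrightarrow> N u = N s"
proof
  assume eq: "N u = N s"
  have "\<tau> \<in> jump_times t0 N s" if "\<tau> \<in> jump_times t0 N u" for \<tau>
  proof (rule ccontr)
    assume "\<tau> \<notin> jump_times t0 N s"
    with that have \<tau>: "s < \<tau>" "\<tau> \<le> u" "t0 < \<tau>" "N \<tau> \<noteq> left_limit N \<tau>"
      by (auto simp: jump_times_def)
    have "N s \<le> left_limit N \<tau>" "left_limit N \<tau> \<le> N \<tau>" "N \<tau> \<le> N u"
      using \<tau> assms by (auto intro: counting_path_mono counting_path_le_left_limit
          left_limit_le_counting_path)
    with eq \<tau>(4) show False by simp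
  qed
  then show "jump_times t0 N u = jump_times t0 N s"
    using assms by (auto simp: jump_times_def)
next
  assume eq: "jump_times t0 N u = jump_times t0 N s"
  show "N u = N s"
  proof (rule ccontr)
    assume neq: "N u \<noteq> N s"
    \<comment> \<open>The supremum of the times at which \<open>N\<close> still has its value at
      \<open>s\<close> is the missing jump time: below it the path is constant, and by right
      continuity it has already left that value there.\<close>
    define A where "A = {r \<in> {s..u}. N r = N s}"
    define \<tau> where "\<tau> = Sup A"
    have A: "s \<in> A" "bdd_above A" "\<And>r. r \<in> A \<Longrightarrow> r \<le> u"
      using assms by (auto simp: A_def intro!: bdd_aboveI[of _ u])
    have "s \<le> \<tau>" "\<tau> \<le> u"
      using A by (auto simp: \<tau>_def intro: cSup_upper cSup_least)
    have below: "N r = N s" if r: "s \<le> r" "r < \<tau>" for r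
    proof -
      obtain r' where "r' \<in> A" "r < r'"
        using r A less_cSup_iff[of A r] unfolding \<tau>_def by (metis empty_iff)
      then show ?thesis
        using r counting_path_mono[of s r] counting_path_mono[of r r'] assms
        by (auto simp: A_def)
    qed
    have "N \<tau> \<noteq> N s"
    proof
      assume \<tau>: "N \<tau> = N s"
      then have "\<tau> < u"
        using neq \<open>\<tau> \<le> u\<close> by (cases "\<tau> = u") auto
      moreover have "eventually (\<lambda>r. N r = N s) (at_right \<tau>)"
        using counting_path_eventually_right[of \<tau>] \<tau> \<open>s \<le> \<tau>\<close> assms by simp
      ultimately obtain c where c: "\<tau> < c" "\<And>r. \<tau> < r \<Longrightarrow> r < c \<Longrightarrow> N r = N s"
        by (auto simp: eventually_at_right)
      define r where "r = (\<tau> + min c u) / 2"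
      have "\<tau> < r" "r < c" "r < u"
        using c \<open>\<tau> < u\<close> by (auto simp: r_def min_def field_simps)
      then have "r \<in> A"
        using c \<open>s \<le> \<tau>\<close> by (auto simp: A_def)
      then show False
        using \<open>\<tau> < r\<close> A(2) cSup_upper[of r A] by (simp add: \<tau>_def)
    qed
    then have "s < \<tau>"
      using \<open>s \<le> \<tau>\<close> by (cases "s = \<tau>") auto
    moreover have "left_limit N \<tau> = N s"
    proof (intro left_limit_eqI tendsto_eventually eventually_at_left_interval[of s])
      fix r assume "s < r" "r < \<tau>"
      then show "N r = N s"
        by (intro below) auto
    qed fact
    ultimately have "\<tau> \<in> jump_times t0 N u - jump_times t0 N s"
      using \<open>\<tau> \<le> u\<close> \<open>N \<tau> \<noteq> N s\<close> assms by (auto simp: jump_times_def)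
    with eq show False by simp
  qed
qed

text \<open>At a jump the left limit of \<open>z\<close> cancels and the left limit of
  \<open>x\<close> remains, which is a value of \<open>x\<close> by continuity. Only the last jump
  before \<open>u\<close> therefore matters, however many there are.\<close>

lemma sample_and_hold:
  fixes x z :: "real \<Rightarrow> real"
  assumes x: "continuous_on {t0..} x"
    and z: "cadlag_from t0 z"
    and zeq: "\<And>t. t0 \<le> t \<Longrightarrow>
      z t = z t0 + (\<Sum>\<tau>\<in>jump_times t0 N t. left_limit x \<tau> - left_limit z \<tau>)"
    and s: "t0 \<le> s" "s \<le> u"
  shows "N u = N s \<Longrightarrow> z u = z s"
    and "N u \<noteq> N s \<Longrightarrow> \<exists>\<tau>\<in>{s..u}. z u = x \<tau>"
proof -
  show "z u = z s" if "N u = N s"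
    using that zeq[of u] zeq[of s] s jump_times_eq_iff[OF s] by simp
next
  assume "N u \<noteq> N s"
  let ?J = "jump_times t0 N u"
  have "?J \<noteq> jump_times t0 N s" "jump_times t0 N s \<subseteq> ?J"
    using \<open>N u \<noteq> N s\<close> jump_times_eq_iff[OF s] s by (auto simp: jump_times_def)
  then obtain \<sigma> where "\<sigma> \<in> ?J" "\<sigma> \<notin> jump_times t0 N s"
    by blast
  then have \<sigma>: "\<sigma> \<in> ?J" "s < \<sigma>"
    by (auto simp: jump_times_def)
  define \<tau> where "\<tau> = Max ?J"
  have \<tau>: "\<tau> \<in> ?J" "\<And>\<sigma>. \<sigma> \<in> ?J \<Longrightarrow> \<sigma> \<le> \<tau>"
    using \<sigma> finite_jump_times[of u] unfolding \<tau>_def by (auto intro: Max_in)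
  have "s < \<tau>" "t0 < \<tau>" "\<tau> \<le> u"
    using \<sigma> \<tau>(2)[of \<sigma>] \<tau>(1) s by (auto simp: jump_times_def)
  define J' where "J' = ?J - {\<tau>}"
  define c where "c = z t0 + (\<Sum>\<rho>\<in>J'. left_limit x \<rho> - left_limit z \<rho>)"
  \<comment> \<open>The last jump before \<tau>, or \<open>t0\<close> if \<tau> is the first one. On
    \<open>(a, \<tau>)\<close> the copy is constant, which identifies its left limit at
    \<tau>.\<close>
  define a where "a = Max (insert t0 J')"
  have fin: "finite J'"
    using finite_jump_times[of u] by (simp add: J'_def)
  have a: "a < \<tau>" "t0 \<le> a" "\<And>\<rho>. \<rho> \<in> J' \<Longrightarrow> \<rho> \<le> a"
  proof -
    have "a \<in> insert t0 J'"
      using fin unfolding a_def by (intro Max_in) auto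
    then show "a < \<tau>"
      using \<tau>(2) \<open>t0 < \<tau>\<close> by (auto simp: J'_def intro: order.not_eq_order_implies_strict)
  qed (use fin in \<open>auto simp: a_def\<close>)
  have "z r = c" if "a < r" "r < \<tau>" for r
  proof -
    have "jump_times t0 N r = J'"
      using that a \<open>\<tau> \<le> u\<close> \<tau>(2) unfolding J'_def by (force simp: jump_times_def)
    then show ?thesis
      using zeq[of r] that a by (simp add: c_def)
  qed
  then have zl: "left_limit z \<tau> = c"
    using a(1) by (intro left_limit_eqI tendsto_eventually eventually_at_left_interval[of a])
  have "(x \<longlongrightarrow> x \<tau>) (at \<tau> within {t0..})"
    using x \<open>t0 < \<tau>\<close> by (auto simp: continuous_on_def)
  moreover have "at \<tau> within {t0..} = at \<tau>"
    using \<open>t0 < \<tau>\<close> by (intro at_within_nhd[of _ "{t0<..}"]) auto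
  ultimately have "(x \<longlongrightarrow> x \<tau>) (at_left \<tau>)"
    by (simp add: filterlim_at_split)
  then have xl: "left_limit x \<tau> = x \<tau>"
    by (rule left_limit_eqI)
  have J: "?J = insert \<tau> J'" "\<tau> \<notin> J'"
    using \<tau>(1) by (auto simp: J'_def)
  have "z u = c + (left_limit x \<tau> - left_limit z \<tau>)"
    using zeq[of u] s fin J(2) unfolding J(1) by (simp add: c_def)
  also have "\<dots> = x \<tau>"
    by (simp add: zl xl)
  finally show "\<exists>\<tau>\<in>{s..u}. z u = x \<tau>"
    using \<open>s < \<tau>\<close> \<open>\<tau> \<le> u\<close> by auto
qed

end

section \<open>Drift and copy errors\<close>

text \<open>Row \<open>i\<close> is the view that agent \<open>i\<close> has of the whole vector,
  minus the true vector. Entries owned by \<open>i\<close> reduce to those of \<open>z\<close>,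
  which vanish on \<open>state_space\<close>, so the map stays linear and no restricted index set is
  required.\<close>

definition copy_error ::
  "('d \<Rightarrow> 'n) \<Rightarrow> (real^'d) \<times> (real^'d^'n) \<Rightarrow> real^'d^'n" where
  "copy_error b s = (\<chi> i. snd s $ i + subvec b i (fst s) - fst s)"

text \<open>The negative of the velocity of \<open>x\<close> in error coordinates: agent
  \<open>b k\<close> evaluates coordinate \<open>k\<close> of the gradient at its own view, whose
  displacement from the minimiser is \<open>X + E $ b k\<close>.\<close>

definition drift ::
  "real^'d^'d \<Rightarrow> ('d::finite \<Rightarrow> 'n::finite) \<Rightarrow> real^'d \<Rightarrow> real^'d^'n \<Rightarrow> real^'d" where
  "drift Q b X E = Q *v X + (\<chi> k. (Q *v (E $ b k)) $ k)"

section \<open>Block algebra of the partition and linearity of the error coordinates\<close>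

lemma linear_subvec: "linear (subvec b i)"
  by (rule linearI) (auto simp: subvec_def vec_eq_iff)

lemma sum_subvec: "(\<Sum>i\<in>UNIV. subvec b i v) = v" for b :: "'d::finite \<Rightarrow> 'n::finite"
  by (simp add: vec_eq_iff subvec_def)

lemma sum_subvec_split:
  fixes b :: "'d::finite \<Rightarrow> 'n::finite"
  shows "(\<Sum>j\<in>UNIV - {i}. subvec b j v) = v - subvec b i v"
  by (simp add: sum_diff1 sum_subvec)

lemma submat_mult_subvec:
  fixes b :: "'d::finite \<Rightarrow> 'n::finite"
  shows "submat b i j Q *v subvec b j v = subvec b i (Q *v subvec b j v)"
  by (auto simp: vec_eq_iff submat_def subvec_def matrix_vector_mult_def intro!: sum.cong)

text \<open>Since the own entries of \<open>z\<close> vanish, the own state and the copies add up to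
  a single view, and the sum over blocks collapses to one block of a full matrix product.\<close>

lemma block_row_mult:
  fixes b :: "'d::finite \<Rightarrow> 'n::finite"
  assumes "subvec b i z = 0"
  shows "submat b i i Q *v subvec b i x + (\<Sum>j\<in>UNIV - {i}. submat b i j Q *v subvec b j z)
    = subvec b i (Q *v (subvec b i x + z))"
proof -
  have "(\<Sum>j\<in>UNIV - {i}. submat b i j Q *v subvec b j z)
    = subvec b i (Q *v (\<Sum>j\<in>UNIV - {i}. subvec b j z))"
    by (simp add: submat_mult_subvec linear_sum[OF linear_subvec]
      linear_sum[OF matrix_vector_mul_linear])
  then show ?thesis
    using assms by (simp add: sum_subvec_split submat_mult_subvec matrix_vector_right_distrib
        linear_add[OF linear_subvec])
qed

lemma linear_drift: "linear (\<lambda>(X, E). drift Q b X E)"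
  by (rule linearI)
    (auto simp: drift_def vec_eq_iff matrix_vector_right_distrib matrix_vector_mult_scaleR algebra_simps)

lemma drift_diff: "drift Q b (X - X') (E - E') = drift Q b X E - drift Q b X' E'"
  using linear_diff[OF linear_drift[of Q b], of "(X, E)" "(X', E')"] by simp

lemma drift_bound:
  obtains L where "0 < L" "\<And>X E. norm (drift Q b X E) \<le> L * (norm X + norm E)"
proof -
  obtain L where L: "0 < L" "\<And>p. norm ((\<lambda>(X, E). drift Q b X E) p) \<le> L * norm p"
    using linear_bounded_pos[OF linear_drift[of Q b]] by blast
  have "norm (drift Q b X E) \<le> L * (norm X + norm E)" for X E
  proof -
    have "norm (drift Q b X E) \<le> L * norm (X, E)"
      using L(2)[of "(X, E)"] by simp
    also have "\<dots> \<le> L * (norm X + norm E)"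
      using L(1) by (intro mult_left_mono norm_Pair_le) auto
    finally show ?thesis .
  qed
  with L(1) show ?thesis by (rule that)
qed

lemma copy_error_component:
  "copy_error b s $ i $ k = (if b k = i then snd s $ i $ k else snd s $ i $ k - fst s $ k)"
  by (simp add: copy_error_def subvec_def)

lemma linear_copy_error: "linear (copy_error b)"
  by (rule linearI) (auto simp: copy_error_component vec_eq_iff algebra_simps)

lemma copy_error_reference_state: "copy_error b (reference_state b y) = 0"
  by (simp add: copy_error_component vec_eq_iff reference_state_def subvec_def)

lemma state_space_component:
  assumes "s \<in> state_space b" "b k = i"
  shows "snd s $ i $ k = 0"
proof -
  have "subvec b i (snd s $ i) $ k = 0"
    using assms by (auto simp: state_space_def split_beta)
  then show ?thesis
    using assms(2) by (simp add: subvec_def)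
qed

section \<open>Integral equations restarted at a later time, and continuity of their
  solutions\<close>

lemma has_integral_increment:
  fixes f g :: "real \<Rightarrow> 'b::banach"
  assumes f: "\<And>t. t0 \<le> t \<Longrightarrow> (g has_integral (f t - f t0)) {t0..t}"
    and "t0 \<le> s" "s \<le> u"
  shows "(g has_integral (f u - f s)) {s..u}"
proof -
  have "t0 \<le> u"
    using assms(2,3) by simp
  have "g integrable_on {s..u}"
    by (rule integrable_on_subinterval[OF has_integral_integrable[OF f[OF \<open>t0 \<le> u\<close>]]])
      (simp add: assms(2))
  then obtain I where I: "(g has_integral I) {s..u}"
    by (auto simp: integrable_on_def)
  have "f s - f t0 + I = f u - f t0"
    by (rule has_integral_unique[OF has_integral_combine[OF assms(2,3) f[OF assms(2)] I]
          f[OF \<open>t0 \<le> u\<close>]])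
  then have "I = f u - f s"
    by (simp add: algebra_simps)
  with I show ?thesis
    by simp
qed

text \<open>Near \<open>t\<close> the function is an indefinite integral over
  \<open>{t0..t + 1}\<close>. This makes \<open>x\<close> continuous, as sampling by
  \<open>sample_and_hold\<close> requires.\<close>

lemma continuous_on_of_has_integral:
  fixes f g :: "real \<Rightarrow> 'b::banach"
  assumes f: "\<And>t. t0 \<le> t \<Longrightarrow> (g has_integral (f t - f t0)) {t0..t}"
  shows "continuous_on {t0..} f"
proof -
  have "continuous (at t within {t0..}) f" if "t0 \<le> t" for t
  proof -
    have eq: "f r = f t0 + integral {t0..r} g" if "t0 \<le> r" for r
      using integral_unique[OF f[OF that]] by simp
    have "continuous_on {t0..t + 1} (\<lambda>r. f t0 + integral {t0..r} g)"
      using f[of "t + 1"] that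
      by (intro continuous_intros indefinite_integral_continuous_1) auto
    then have "continuous_on {t0..t + 1} f"
      by (rule continuous_on_eq) (rule eq[symmetric], simp)
    then have "continuous (at t within {t0..t + 1}) f"
      using that by (simp add: continuous_on_eq_continuous_within)
    moreover have "at t within {t0..t + 1} = at t within {t0..}"
      by (rule at_within_nhd[of _ "{..<t + 1}"]) auto
    ultimately show ?thesis
      by (simp add: continuous_within)
  qed
  then show ?thesis
    by (simp add: continuous_on_eq_continuous_within)
qed

section \<open>The two integral equations along one path\<close>

context
  fixes b :: "'d::finite \<Rightarrow> 'n::finite" and Q :: "real^'d^'d" and q y :: "real^'d"
    and t0 :: real and N :: "'n \<times> 'n \<Rightarrow> real \<Rightarrow> nat" and s :: "real \<Rightarrow> (real^'d) \<times> (real^'d^'n)"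
  assumes flow: "flow_path b Q q t0 N (\<lambda>t. fst (s t)) (\<lambda>t. snd (s t))"
    and state: "\<And>t. t0 \<le> t \<Longrightarrow> s t \<in> state_space b"
    and cadlag: "cadlag_from t0 s"
    and counting: "\<And>c. c \<in> channels \<Longrightarrow> counting_path t0 (N c)"
    and y: "Q *v y = - q"
begin

text \<open>Summing the equations of all agents reassembles the full vector, and
  \<open>Q *v y = - q\<close> absorbs the affine term, leaving a linear equation in the error
  coordinates.\<close>

lemma flow_has_integral_drift:
  assumes "t0 \<le> t"
  shows "((\<lambda>r. - drift Q b (fst (s r) - y) (copy_error b (s r)))
    has_integral (fst (s t) - fst (s t0))) {t0..t}"
proof -
  have "((\<lambda>r. - subvec b i (Q *v (subvec b i (fst (s r)) + snd (s r) $ i) + q))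
      has_integral (subvec b i (fst (s t)) - subvec b i (fst (s t0)))) {t0..t}" for i
  proof (rule has_integral_eq)
    show "((\<lambda>r. - (submat b i i Q *v subvec b i (fst (s r))
        + (\<Sum>j\<in>UNIV - {i}. submat b i j Q *v subvec b j (snd (s r) $ i)) + subvec b i q))
      has_integral (subvec b i (fst (s t)) - subvec b i (fst (s t0)))) {t0..t}"
      using flow assms unfolding flow_path_def by blast
    fix r assume "r \<in> {t0..t}"
    then have "subvec b i (snd (s r) $ i) = 0"
      using state[of r] by (auto simp: state_space_def split_beta)
    then show "- (submat b i i Q *v subvec b i (fst (s r))
        + (\<Sum>j\<in>UNIV - {i}. submat b i j Q *v subvec b j (snd (s r) $ i)) + subvec b i q)
      = - subvec b i (Q *v (subvec b i (fst (s r)) + snd (s r) $ i) + q)"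
      by (simp add: block_row_mult linear_add[OF linear_subvec])
  qed
  then have "((\<lambda>r. \<Sum>i\<in>UNIV. - subvec b i (Q *v (subvec b i (fst (s r)) + snd (s r) $ i) + q))
      has_integral (\<Sum>i\<in>UNIV. subvec b i (fst (s t)) - subvec b i (fst (s t0)))) {t0..t}"
    by (intro has_integral_sum) auto
  moreover have "(\<Sum>i\<in>UNIV. - subvec b i (Q *v (subvec b i (fst (s r)) + snd (s r) $ i) + q))
      = - drift Q b (fst (s r) - y) (copy_error b (s r))" for r
  proof -
    have "Q *v (subvec b i (fst (s r)) + snd (s r) $ i) + q
      = Q *v (fst (s r) - y) + Q *v (copy_error b (s r) $ i)" for i
      using y by (simp add: copy_error_def matrix_vector_right_distrib
          matrix_vector_mult_diff_distrib algebra_simps)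
    then show ?thesis
      by (simp add: vec_eq_iff drift_def subvec_def sum_negf)
  qed
  ultimately show ?thesis
    by (simp add: sum_subtractf sum_subvec)
qed

lemma continuous_on_flow_fst: "continuous_on {t0..} (\<lambda>t. fst (s t))"
  by (rule continuous_on_of_has_integral[OF flow_has_integral_drift])

text \<open>Projection to one coordinate turns the vector equation into the scalar one of
  \<open>sample_and_hold\<close>; the path is cadlag, so left limits commute with the
  projections.\<close>

lemma copy_sample_and_hold:
  assumes "b k \<noteq> i" "t0 \<le> p" "p \<le> u"
  shows "N (b k, i) u = N (b k, i) p \<Longrightarrow> snd (s u) $ i $ k = snd (s p) $ i $ k"
    and "N (b k, i) u \<noteq> N (b k, i) p \<Longrightarrow> \<exists>\<tau>\<in>{p..u}. snd (s u) $ i $ k = fst (s \<tau>) $ k"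
proof -
  define x where "x t = fst (s t) $ k" for t
  define z where "z t = snd (s t) $ i $ k" for t
  have ch: "(b k, i) \<in> channels"
    using assms(1) by (simp add: channels_def)
  have x: "continuous_on {t0..} x"
    unfolding x_def by (intro continuous_intros continuous_on_flow_fst)
  have z: "cadlag_from t0 z"
    unfolding cadlag_from_def z_def
  proof (intro conjI allI impI)
    fix t assume "t0 \<le> t"
    then show "((\<lambda>t. snd (s t) $ i $ k) \<longlongrightarrow> snd (s t) $ i $ k) (at_right t)"
      using cadlag unfolding cadlag_from_def by (intro tendsto_intros) auto
  next
    fix t assume "t0 < t"
    then obtain l where "(s \<longlongrightarrow> l) (at_left t)"
      using cadlag unfolding cadlag_from_def by blast
    then have "((\<lambda>t. snd (s t) $ i $ k) \<longlongrightarrow> snd l $ i $ k) (at_left t)"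
      by (intro tendsto_intros)
    then show "\<exists>l. ((\<lambda>t. snd (s t) $ i $ k) \<longlongrightarrow> l) (at_left t)" by blast
  qed
  have lim: "left_limit (\<lambda>t. fst (s t)) \<tau> $ k = left_limit x \<tau>"
    "left_limit (\<lambda>t. snd (s t)) \<tau> $ i $ k = left_limit z \<tau>" if "t0 < \<tau>" for \<tau>
  proof -
    have l: "(s \<longlongrightarrow> left_limit s \<tau>) (at_left \<tau>)"
      using tendsto_left_limit[OF cadlag that] .
    have "left_limit (\<lambda>t. fst (s t)) \<tau> = fst (left_limit s \<tau>)"
      "left_limit (\<lambda>t. snd (s t)) \<tau> = snd (left_limit s \<tau>)"
      "left_limit x \<tau> = fst (left_limit s \<tau>) $ k" "left_limit z \<tau> = snd (left_limit s \<tau>) $ i $ k"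
      unfolding x_def z_def by (rule left_limit_eqI, intro tendsto_intros l)+
    then show "left_limit (\<lambda>t. fst (s t)) \<tau> $ k = left_limit x \<tau>"
      "left_limit (\<lambda>t. snd (s t)) \<tau> $ i $ k = left_limit z \<tau>" by simp_all
  qed
  have zeq: "z t = z t0 + (\<Sum>\<tau>\<in>jump_times t0 (N (b k, i)) t. left_limit x \<tau> - left_limit z \<tau>)"
    if "t0 \<le> t" for t
  proof -
    have "subvec b (b k) (snd (s t) $ i) = subvec b (b k) (snd (s t0) $ i)
        + (\<Sum>\<tau>\<in>jump_times t0 (N (b k, i)) t. subvec b (b k) (left_limit (\<lambda>t. fst (s t)) \<tau>)
            - subvec b (b k) (left_limit (\<lambda>t. snd (s t)) \<tau> $ i))"
      using bspec[OF conjunct2[OF flow[unfolded flow_path_def]] ch] that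
      unfolding prod.case by blast
    from arg_cong[OF this, of "\<lambda>v. v $ k"]
    have "z t = z t0 + (\<Sum>\<tau>\<in>jump_times t0 (N (b k, i)) t.
        left_limit (\<lambda>t. fst (s t)) \<tau> $ k - left_limit (\<lambda>t. snd (s t)) \<tau> $ i $ k)"
      by (simp add: subvec_def z_def)
    also have "\<dots> = z t0 + (\<Sum>\<tau>\<in>jump_times t0 (N (b k, i)) t. left_limit x \<tau> - left_limit z \<tau>)"
      by (intro arg_cong2[of _ _ _ _ "(+)"] sum.cong refl) (simp add: lim jump_times_def)
    finally show ?thesis .
  qed
  show "N (b k, i) u = N (b k, i) p \<Longrightarrow> snd (s u) $ i $ k = snd (s p) $ i $ k"
    using sample_and_hold(1)[OF counting[OF ch] x z zeq assms(2,3)] by (simp add: z_def)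
  show "N (b k, i) u \<noteq> N (b k, i) p \<Longrightarrow> \<exists>\<tau>\<in>{p..u}. snd (s u) $ i $ k = fst (s \<tau>) $ k"
    using sample_and_hold(2)[OF counting[OF ch] x z zeq assms(2,3)] by (simp add: z_def x_def)
qed

end

section \<open>One time step of a path\<close>

lemma norm_matrix_squared: "(norm (E :: real^'d^'n))\<^sup>2 = (\<Sum>i\<in>UNIV. \<Sum>k\<in>UNIV. (E $ i $ k)\<^sup>2)"
  unfolding power2_norm_eq_inner inner_vec_def by (simp add: power2_eq_square)

lemma entry_le_norm: "\<bar>(E :: real^'d^'n) $ i $ k\<bar> \<le> norm E"
  by (meson component_le_norm_cart Finite_Cartesian_Product.norm_nth_le order_trans)

lemma norm_le_entry_bound:
  fixes E :: "real^'d^'n"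
  assumes "\<And>i k. \<bar>E $ i $ k\<bar> \<le> c"
  shows "norm E \<le> real (CARD('n) * CARD('d)) * c"
proof -
  have "norm (E $ i) \<le> real CARD('d) * c" for i
    using norm_le_l1_cart[of "E $ i"] sum_bounded_above[of UNIV "\<lambda>k. \<bar>E $ i $ k\<bar>" c] assms
    by (simp add: order_trans)
  then have "(\<Sum>i\<in>UNIV. norm (E $ i)) \<le> real CARD('n) * (real CARD('d) * c)"
    using sum_bounded_above[of UNIV "\<lambda>i. norm (E $ i)" "real CARD('d) * c"] by simp
  moreover have "norm E \<le> (\<Sum>i\<in>UNIV. norm (E $ i))"
    unfolding norm_vec_def by (rule L2_set_le_sum) simp
  ultimately show ?thesis by (simp add: mult.assoc)
qed

text \<open>The derivative of \<open>|X|^2 + |E|^2\<close> while no channel fires: \<open>X\<close>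
  then moves with velocity \<open>- drift\<close>, and the entries of \<open>E\<close> not owned by
  their row with velocity \<open>+ drift\<close>. Own entries are zero on \<open>state_space\<close>
  and contribute nothing.\<close>

definition dissipation ::
  "real^'d^'d \<Rightarrow> ('d::finite \<Rightarrow> 'n::finite) \<Rightarrow> real^'d \<Rightarrow> real^'d^'n \<Rightarrow> real" where
  "dissipation Q b X E = 2 * ((\<Sum>i\<in>UNIV. (E $ i) \<bullet> drift Q b X E) - X \<bullet> drift Q b X E)"

text \<open>The quadratic form yields \<open>- 2 * lambda_min Q * |X|^2\<close>. Of this the part
  \<delta> is given up to absorb the cross terms between \<open>X\<close> and \<open>E\<close>; the
  price is the multiple of \<open>|E|^2\<close> that communication has to compensate.\<close>

lemma dissipation_bound:
  fixes Q :: "real^'d^'d" and b :: "'d::finite \<Rightarrow> 'n::finite"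
  assumes sym: "transpose Q = Q"
    and L: "0 < L" "\<And>X E. norm (drift Q b X E) \<le> L * (norm X + norm E)"
    and \<beta>: "\<beta> < 2 * lambda_min Q"
  defines "A \<equiv> L * real (CARD('n) * CARD('d))"
  defines "\<delta> \<equiv> 2 * lambda_min Q - \<beta>"
  shows "dissipation Q b X E
    \<le> - \<beta> * ((norm X)\<^sup>2 + (norm E)\<^sup>2) + (\<beta> + 4 * A\<^sup>2 / \<delta> + 2 * A) * (norm E)\<^sup>2"
proof -
  define K where "K = real (CARD('n) * CARD('d))"
  have d: "(1::real) \<le> real CARD('d)" and n: "(1::real) \<le> real CARD('n)"
    by (simp_all add: Suc_le_eq)
  have K: "1 \<le> K" "real CARD('n) \<le> K"
    using mult_mono[OF n d] mult_left_mono[OF d, of "real CARD('n)"] by (auto simp: K_def)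
  have LA: "L \<le> A" "L * real CARD('n) \<le> A"
    using mult_left_mono[OF K(1), of L] mult_left_mono[OF K(2), of L] L by (auto simp: A_def K_def)
  have "drift Q b X E = drift Q b X 0 + drift Q b 0 E"
    using drift_diff[of Q b X 0 0 "- E"] drift_diff[of Q b 0 0 0 E] drift_diff[of Q b 0 0 0 0]
    by simp
  moreover have "drift Q b X 0 = Q *v X"
    by (simp add: drift_def vec_eq_iff)
  ultimately have "X \<bullet> drift Q b X E = X \<bullet> (Q *v X) + X \<bullet> drift Q b 0 E"
    by (simp add: inner_add_right)
  moreover have "\<bar>X \<bullet> drift Q b 0 E\<bar> \<le> norm X * (L * norm E)"
    using Cauchy_Schwarz_ineq2[of X "drift Q b 0 E"] L(2)[of 0 E]
    by (simp add: mult_left_mono order_trans)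
  moreover have "norm X * (L * norm E) \<le> A * norm X * norm E"
    using mult_right_mono[OF LA(1), of "norm X * norm E"] by (simp add: mult_ac)
  ultimately have 1: "- (X \<bullet> drift Q b X E)
      \<le> - lambda_min Q * (norm X)\<^sup>2 + A * norm X * norm E"
    using lambda_min_le_quadratic_form[OF sym, of X] by simp
  have "(\<Sum>i\<in>UNIV. (E $ i) \<bullet> drift Q b X E) \<le> (\<Sum>i\<in>(UNIV :: 'n set). norm E * (L * (norm X + norm E)))"
  proof (rule sum_mono)
    fix i
    have "(E $ i) \<bullet> drift Q b X E \<le> norm (E $ i) * norm (drift Q b X E)"
      by (rule norm_cauchy_schwarz)
    also have "\<dots> \<le> norm E * (L * (norm X + norm E))"
      by (intro mult_mono L Finite_Cartesian_Product.norm_nth_le) auto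
    finally show "(E $ i) \<bullet> drift Q b X E \<le> norm E * (L * (norm X + norm E))" .
  qed
  also have "\<dots> = (L * real CARD('n)) * (norm E * (norm X + norm E))"
    by simp
  also have "\<dots> \<le> A * (norm E * (norm X + norm E))"
    by (intro mult_right_mono LA) auto
  finally have 2: "(\<Sum>i\<in>UNIV. (E $ i) \<bullet> drift Q b X E) \<le> A * norm X * norm E + A * (norm E)\<^sup>2"
    by (simp add: algebra_simps power2_eq_square)
  have \<delta>: "0 < \<delta>"
    using \<beta> by (simp add: \<delta>_def)
  \<comment> \<open>Young's inequality with weight \<delta> for the total cross term
    \<open>4 * A * norm X * norm E\<close>, half of which comes from \<open>1\<close> and half from
    \<open>2\<close>.\<close>
  have "0 \<le> (\<delta> * norm X - 2 * A * norm E)\<^sup>2"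
    by simp
  then have "4 * A * norm X * norm E * \<delta> \<le> \<delta> * (\<delta> * (norm X)\<^sup>2) + 4 * A\<^sup>2 * (norm E)\<^sup>2"
    by (simp add: power2_diff power_mult_distrib) (simp add: algebra_simps power2_eq_square)
  then have "4 * A * norm X * norm E \<le> \<delta> * (norm X)\<^sup>2 + 4 * A\<^sup>2 / \<delta> * (norm E)\<^sup>2"
    using \<delta> by (simp add: field_simps)
  with 1 2 show ?thesis
    unfolding dissipation_def \<delta>_def by (simp add: algebra_simps)
qed

text \<open>An explicit Euler step with controlled remainder, free of probability.
  \<open>J k i\<close> marks the entries refreshed during the step, and \<open>j\<close> is at least
  \<open>1\<close> as soon as there is one. A refreshed entry loses its old square, hence the double
  sum on the left; its presence spoils the expansion only to first order in \<open>h\<close>, which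
  is charged to \<open>j\<close>.\<close>

lemma one_step_estimate:
  fixes Q :: "real^'d^'d" and b :: "'d::finite \<Rightarrow> 'n::finite"
    and X :: "real \<Rightarrow> real^'d" and E :: "real \<Rightarrow> real^'d^'n" and J :: "'d \<Rightarrow> 'n \<Rightarrow> bool"
  assumes L: "0 < L" "\<And>X E. norm (drift Q b X E) \<le> L * (norm X + norm E)"
  defines "K \<equiv> real (CARD('n) * CARD('d))"
  defines "A \<equiv> L * K"
  assumes h: "0 \<le> h" "6 * A * h \<le> 1" and u: "u = p + h"
    and int: "\<And>r. r \<in> {p..u} \<Longrightarrow>
      ((\<lambda>\<rho>. - drift Q b (X \<rho>) (E \<rho>)) has_integral (X r - X p)) {p..r}"
    and cont: "continuous_on {p..u} X"
    and own: "\<And>i k r. b k = i \<Longrightarrow> r \<in> {p..u} \<Longrightarrow> E r $ i $ k = 0"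
    and hold: "\<And>i k r. b k \<noteq> i \<Longrightarrow> \<not> J k i \<Longrightarrow> r \<in> {p..u} \<Longrightarrow>
      E r $ i $ k = E p $ i $ k - (X r - X p) $ k"
    and sample_hold: "\<And>i k r. b k \<noteq> i \<Longrightarrow> r \<in> {p..u} \<Longrightarrow>
      E r $ i $ k = E p $ i $ k - (X r - X p) $ k \<or> (\<exists>\<tau>\<in>{p..r}. E r $ i $ k = (X \<tau> - X r) $ k)"
    and sample: "\<And>i k. b k \<noteq> i \<Longrightarrow> J k i \<Longrightarrow> \<exists>\<tau>\<in>{p..u}. E u $ i $ k = (X \<tau> - X u) $ k"
    and j: "0 \<le> j" "\<And>i k. b k \<noteq> i \<Longrightarrow> J k i \<Longrightarrow> 1 \<le> j"
  defines "V \<equiv> \<lambda>r. (norm (X r))\<^sup>2 + (norm (E r))\<^sup>2"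
  shows "V u + (\<Sum>i\<in>UNIV. \<Sum>k\<in>UNIV. of_bool (J k i) * (E p $ i $ k)\<^sup>2)
    \<le> V p + h * dissipation Q b (X p) (E p)
      + (K + 1) * (48 * A\<^sup>2 * h\<^sup>2 + 16 * A * h * j) * V p"
proof -
  define R where "R = norm (X p) + norm (E p)"
  define G where "G = drift Q b (X p) (E p)"
  have "1 \<le> CARD('n) * CARD('d)"
    by (simp add: Suc_le_eq)
  then have K: "1 \<le> K"
    unfolding K_def by linarith
  have LA: "L \<le> A" "0 < A"
    using mult_left_mono[OF K, of L] L K by (auto simp: A_def)
  have R: "0 \<le> R" "norm (X p) \<le> R" "norm (E p) \<le> R"
    by (auto simp: R_def)
  have pu: "p \<in> {p..u}" "u \<in> {p..u}"
    using h u by auto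
  obtain r0 where r0: "r0 \<in> {p..u}" "\<And>r. r \<in> {p..u} \<Longrightarrow> norm (X r - X p) \<le> norm (X r0 - X p)"
    using continuous_attains_sup[of "{p..u}" "\<lambda>r. norm (X r - X p)"] pu cont
    by (force intro!: continuous_intros)
  txt \<open>A jump copies a value of \<open>X\<close> from the same interval, so the maximal displacement \<open>P\<close>
    of \<open>X\<close> controls \<open>E\<close> whatever the number of jumps. The resulting inequality
    \<open>P \<le> A h (R + 3 P)\<close> is solved for \<open>P\<close> using \<open>6 A h \<le> 1\<close>.\<close>
  define P where "P = norm (X r0 - X p)"
  have P: "norm (X r - X p) \<le> P" "\<bar>(X r - X p) $ k\<bar> \<le> P" if "r \<in> {p..u}" for r k
    using r0(2)[OF that] component_le_norm_cart[of "X r - X p" k] by (auto simp: P_def)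
  have P0: "0 \<le> P"
    by (simp add: P_def)
  have P2: "\<bar>(X \<tau> - X r) $ k\<bar> \<le> 2 * P" if "\<tau> \<in> {p..u}" "r \<in> {p..u}" for \<tau> r k
    using P(2)[OF that(1), of k] P(2)[OF that(2), of k] by simp
  have Eb: "norm (E r) \<le> K * (norm (E p) + 2 * P)" if r: "r \<in> {p..u}" for r
    unfolding K_def
  proof (rule norm_le_entry_bound)
    fix i k
    show "\<bar>E r $ i $ k\<bar> \<le> norm (E p) + 2 * P"
    proof (cases "b k = i")
      case True
      then show ?thesis using own[OF True r] P0 by simp
    next
      case False
      from sample_hold[OF this r] show ?thesis
      proof
        assume "E r $ i $ k = E p $ i $ k - (X r - X p) $ k"
        then show ?thesis
          using P(2)[OF r, of k] entry_le_norm[of "E p" i k] P0 by simp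
      next
        assume "\<exists>\<tau>\<in>{p..r}. E r $ i $ k = (X \<tau> - X r) $ k"
        then obtain \<tau> where "\<tau> \<in> {p..r}" "E r $ i $ k = (X \<tau> - X r) $ k"
          by blast
        then show ?thesis
          using P2[of \<tau> r k] r norm_ge_zero[of "E p"] by (simp del: norm_ge_zero)
      qed
    qed
  qed
  have G0: "norm (drift Q b (X r) (E r)) \<le> A * (R + 3 * P)" if r: "r \<in> {p..u}" for r
  proof -
    have "norm (X r) \<le> norm (X p) + P"
      using P(1)[OF r] norm_triangle_sub[of "X r" "X p"] by linarith
    also have "\<dots> \<le> K * (norm (X p) + P)"
      using mult_right_mono[OF K, of "norm (X p) + P"] P0 by simp
    finally have "norm (X r) + norm (E r) \<le> K * (R + 3 * P)"
      using Eb[OF r] by (simp add: R_def algebra_simps)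
    then have "L * (norm (X r) + norm (E r)) \<le> L * (K * (R + 3 * P))"
      using L(1) by (intro mult_left_mono) auto
    then show ?thesis
      using L(2)[of "X r" "E r"] by (simp add: A_def)
  qed
  have "P \<le> A * (R + 3 * P) * (r0 - p)"
    using has_integral_bound_real[OF _ finite.emptyI int[OF r0(1)], of "A * (R + 3 * P)"]
      G0 r0(1) LA R(1) P0 by (simp add: P_def)
  also have "\<dots> \<le> A * (R + 3 * P) * h"
    using r0(1) LA R(1) P0 u by (intro mult_left_mono) auto
  finally have "P \<le> A * h * R + 3 * A * h * P"
    by (simp add: algebra_simps)
  moreover have "6 * A * h * P \<le> P"
    using mult_right_mono[OF h(2) P0] by simp
  ultimately have PR: "P \<le> 2 * A * h * R"
    by simp
  have Gn: "norm G \<le> A * R"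
  proof -
    have "norm G \<le> L * R"
      using L(2)[of "X p" "E p"] by (simp add: G_def R_def)
    also have "\<dots> \<le> A * R"
      using LA R by (intro mult_right_mono)
    finally show ?thesis .
  qed
  \<comment> \<open>\<open>w\<close> is the remainder of the Euler step. Without a refresh the drift
    stays within \<open>4 * A\<^sup>2 * h * R\<close> of \<open>G\<close>, giving order
    \<open>h\<^sup>2\<close>; with one, the triangle inequality gives order \<open>h\<close>, and
    \<open>1 \<le> j\<close> puts it into the second term of \<eta>.\<close>
  define w where "w = X u - X p + h *\<^sub>R G"
  define \<eta> where "\<eta> = 4 * A\<^sup>2 * h\<^sup>2 * R + 4 * A * h * R * j"
  have \<eta>0: "0 \<le> \<eta>"
    using LA R h j by (simp add: \<eta>_def)
  have w: "norm w \<le> \<eta>"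
  proof (cases "\<exists>i k. b k \<noteq> i \<and> J k i")
    case True
    have "norm w \<le> norm (X u - X p) + norm (h *\<^sub>R G)"
      unfolding w_def by (rule norm_triangle_ineq)
    also have "\<dots> \<le> P + h * (A * R)"
      using P(1)[OF pu(2)] Gn h(1) by (auto intro!: add_mono mult_left_mono)
    also have "\<dots> \<le> 4 * A * h * R * 1"
    proof -
      have "0 \<le> A * h * R"
        using LA R h by auto
      then show ?thesis
        using PR by (simp add: algebra_simps)
    qed
    also have "\<dots> \<le> 4 * A * h * R * j"
      using True j LA R h by (intro mult_left_mono) auto
    also have "\<dots> \<le> \<eta>"
      using LA R h by (simp add: \<eta>_def)
    finally show ?thesis .
  next
    case False
    have bnd: "norm (- drift Q b (X r) (E r) + G) \<le> 4 * A\<^sup>2 * h * R" if r: "r \<in> {p..u}" for r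
    proof -
      have "norm (E r - E p) \<le> K * P"
        unfolding K_def
      proof (rule norm_le_entry_bound)
        fix i k
        show "\<bar>(E r - E p) $ i $ k\<bar> \<le> P"
        proof (cases "b k = i")
          case True
          then show ?thesis using own[OF True r] own[OF True pu(1)] P0 by simp
        next
          case neq: False
          then have not_jump: "\<not> J k i"
            using False by blast
          have "(E r - E p) $ i $ k = - ((X r - X p) $ k)"
            using hold[OF neq not_jump r] by simp
          then show ?thesis
            using P(2)[OF r, of k] by (simp only: abs_minus_cancel)
        qed
      qed
      moreover have "norm (X r - X p) \<le> K * P"
        using P(1)[OF r] mult_right_mono[OF K P0] by simp
      ultimately have "L * (norm (X r - X p) + norm (E r - E p)) \<le> L * (2 * (K * P))"
        using L(1) by (intro mult_left_mono) auto
      then have "norm (drift Q b (X r - X p) (E r - E p)) \<le> 2 * A * P"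
        using L(2)[of "X r - X p" "E r - E p"] by (simp add: A_def)
      also have "\<dots> \<le> 2 * A * (2 * A * h * R)"
        using PR LA by (intro mult_left_mono) auto
      finally show ?thesis
        by (simp add: drift_diff G_def power2_eq_square norm_minus_commute)
    qed
    have "((\<lambda>r. - drift Q b (X r) (E r) + G) has_integral (X u - X p + (u - p) *\<^sub>R G)) {p..u}"
      using has_integral_add[OF int[OF pu(2)] has_integral_const_real[of G p u]] pu by simp
    then have "norm w \<le> 4 * A\<^sup>2 * h * R * h"
      using has_integral_bound_real[of "4 * A\<^sup>2 * h * R" "{}" "\<lambda>r. - drift Q b (X r) (E r) + G" w p u]
      bnd u h LA R by (simp add: w_def)
    also have "\<dots> \<le> \<eta>"
      using LA R h j by (simp add: \<eta>_def power2_eq_square)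
    finally show ?thesis .
  qed
  have Xu: "X u - X p = w - h *\<^sub>R G"
    by (simp add: w_def)
  \<comment> \<open>A common error for \<open>X\<close> and for each of the \<open>K\<close> entries
    of \<open>E\<close>: a cross term with the remainder plus a squared displacement. The factor
    \<open>4\<close> is due to refreshed entries, which are differences of two values of
    \<open>X\<close>, each within \<open>P\<close> of \<open>X p\<close>.\<close>
  define S where "S = 2 * (R * \<eta>) + 4 * P\<^sup>2"
  have P20: "0 \<le> P\<^sup>2" by simp
  have Rw: "norm v * norm w \<le> R * \<eta>" if "norm v \<le> R" for v :: "real^'d"
    using that w R by (intro mult_mono) auto
  have "(norm (X u))\<^sup>2 = (norm (X p))\<^sup>2 + 2 * (X p \<bullet> (X u - X p)) + (norm (X u - X p))\<^sup>2"
    by (simp add: power2_norm_eq_inner inner_diff algebra_simps inner_commute)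
  also have "X p \<bullet> (X u - X p) = X p \<bullet> w - h * (X p \<bullet> G)"
    by (simp add: Xu inner_diff_right)
  also have "(norm (X u - X p))\<^sup>2 \<le> P\<^sup>2"
    using P(1)[OF pu(2)] by (intro power_mono) auto
  finally have "(norm (X u))\<^sup>2 \<le> (norm (X p))\<^sup>2 + 2 * (X p \<bullet> w - h * (X p \<bullet> G)) + P\<^sup>2"
    by simp
  then have normX: "(norm (X u))\<^sup>2 \<le> (norm (X p))\<^sup>2 - 2 * (h * (X p \<bullet> G)) + S"
    using norm_cauchy_schwarz[of "X p" w] Rw[OF R(2)] P20 unfolding S_def by argo
  \<comment> \<open>Own entries vanish. A held entry is expanded as a square. For a refreshed entry
    the new square is at most \<open>4 * P\<^sup>2\<close>, and the drift term on the right, which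
    it does not follow, is of order \<open>h\<close> and covered by \<eta> because
    \<open>1 \<le> j\<close>.\<close>
  have normE: "(E u $ i $ k)\<^sup>2 + of_bool (J k i) * (E p $ i $ k)\<^sup>2
      \<le> (E p $ i $ k)\<^sup>2 + 2 * (h * (E p $ i $ k * G $ k)) + S" for i k
  proof -
    have wk: "\<bar>E p $ i $ k\<bar> * \<bar>w $ k\<bar> \<le> R * \<eta>"
      using entry_le_norm[of "E p" i k] component_le_norm_cart[of w k] w R by (intro mult_mono) auto
    show ?thesis
    proof (cases "b k = i")
      case True
      then show ?thesis
        using own[OF True pu(1)] own[OF True pu(2)] R \<eta>0 by (simp add: S_def)
    next
      case neq: False
      show ?thesis
      proof (cases "J k i")
        case True
        obtain \<tau> where \<tau>: "\<tau> \<in> {p..u}" "E u $ i $ k = (X \<tau> - X u) $ k"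
          using sample[OF neq True] by blast
        have "(E u $ i $ k)\<^sup>2 \<le> (2 * P)\<^sup>2"
          using power_mono[OF P2[OF \<tau>(1) pu(2), of k] abs_ge_zero, of 2]
          unfolding \<tau>(2) power2_abs .
        then have "(E u $ i $ k)\<^sup>2 \<le> 4 * P\<^sup>2"
          by (simp add: power_mult_distrib)
        moreover have "\<bar>E p $ i $ k * G $ k\<bar> \<le> R * (A * R)"
          unfolding abs_mult
          using entry_le_norm[of "E p" i k] component_le_norm_cart[of G k] Gn R by (intro mult_mono) auto
        then have "h * (- (E p $ i $ k * G $ k)) \<le> h * (R * (A * R))"
          using h(1) by (intro mult_left_mono) auto
        moreover have "h * (R * (A * R)) \<le> R * \<eta>"
        proof -
          have "A * h * R * 1 \<le> A * h * R * j"
            using j(2)[OF neq True] LA R h by (intro mult_left_mono) auto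
          also have "\<dots> \<le> \<eta>"
            using LA R h j by (simp add: \<eta>_def)
          finally have "R * (A * h * R) \<le> R * \<eta>"
            using R by (intro mult_left_mono) auto
          then show ?thesis by (simp add: mult_ac)
        qed
        ultimately show ?thesis
          using True by (simp add: S_def)
      next
        case False
        have "E u $ i $ k = E p $ i $ k - (X u - X p) $ k"
          using hold[OF neq False pu(2)] .
        then have "(E u $ i $ k)\<^sup>2 = (E p $ i $ k)\<^sup>2 - 2 * (E p $ i $ k * (X u - X p) $ k)
            + ((X u - X p) $ k)\<^sup>2"
          by (simp only: power2_diff)
        also have "E p $ i $ k * (X u - X p) $ k = E p $ i $ k * w $ k - h * (E p $ i $ k * G $ k)"
          unfolding Xu by (simp add: algebra_simps)
        also have "((X u - X p) $ k)\<^sup>2 \<le> P\<^sup>2"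
          using P(2)[OF pu(2), of k] P0 by (simp only: abs_le_square_iff[symmetric])
        finally have "(E u $ i $ k)\<^sup>2
            \<le> (E p $ i $ k)\<^sup>2 - 2 * (E p $ i $ k * w $ k - h * (E p $ i $ k * G $ k)) + P\<^sup>2"
          by simp
        moreover have "- (E p $ i $ k * w $ k) \<le> R * \<eta>"
          using wk abs_ge_minus_self[of "E p $ i $ k * w $ k"] unfolding abs_mult by linarith
        moreover have "of_bool (J k i) * (E p $ i $ k)\<^sup>2 = 0"
          using False by simp
        ultimately show ?thesis
          using P20 unfolding S_def by argo
      qed
    qed
  qed
  have "(norm (E u))\<^sup>2 + (\<Sum>i\<in>UNIV. \<Sum>k\<in>UNIV. of_bool (J k i) * (E p $ i $ k)\<^sup>2)
      \<le> (\<Sum>i\<in>(UNIV :: 'n set). \<Sum>k\<in>(UNIV :: 'd set).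
          (E p $ i $ k)\<^sup>2 + 2 * (h * (E p $ i $ k * G $ k)) + S)"
    unfolding norm_matrix_squared sum.distrib[symmetric] by (intro sum_mono normE)
  also have "\<dots> = (norm (E p))\<^sup>2 + 2 * h * (\<Sum>i\<in>UNIV. (E p $ i) \<bullet> G) + K * S"
    by (simp add: sum.distrib norm_matrix_squared sum_distrib_left inner_vec_def K_def mult.assoc)
  finally have total: "V u + (\<Sum>i\<in>UNIV. \<Sum>k\<in>UNIV. of_bool (J k i) * (E p $ i $ k)\<^sup>2)
      \<le> V p + h * dissipation Q b (X p) (E p) + (K + 1) * S"
    using normX by (simp add: V_def dissipation_def G_def algebra_simps)
  \<comment> \<open>Here \<open>24 = 8 + 16\<close>, from \<open>2 * R * \<eta>\<close> and from
    \<open>4 * P\<^sup>2\<close> with \<open>P \<le> 2 * A * h * R\<close>. Passing from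
    \<open>R\<^sup>2\<close> to \<open>V p\<close> doubles the coefficients.\<close>
  have "S \<le> (24 * A\<^sup>2 * h\<^sup>2 + 8 * A * h * j) * R\<^sup>2"
  proof -
    have "P\<^sup>2 \<le> (2 * A * h * R)\<^sup>2"
      using PR P0 by (intro power_mono)
    then show ?thesis
      by (simp add: S_def \<eta>_def power_mult_distrib) (simp add: algebra_simps power2_eq_square)
  qed
  also have "\<dots> \<le> (24 * A\<^sup>2 * h\<^sup>2 + 8 * A * h * j) * (2 * V p)"
  proof (rule mult_left_mono)
    show "R\<^sup>2 \<le> 2 * V p"
      using sum_squares_bound[of "norm (X p)" "norm (E p)"]
      by (simp add: R_def V_def power2_sum)
  qed (use LA h j in auto)
  finally have "(K + 1) * S \<le> (K + 1) * ((24 * A\<^sup>2 * h\<^sup>2 + 8 * A * h * j) * (2 * V p))"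
    using K by (intro mult_left_mono) auto
  with total show ?thesis
    by (simp add: algebra_simps)
qed

section \<open>Independent increments\<close>

lemma (in prob_space) indep_var_of_indep_set:
  assumes "indep_set (sets G) (sets H)" "space G = space M" "space H = space M"
    and "X \<in> measurable G S" "Y \<in> measurable H T"
  shows "indep_var S X T Y"
  unfolding indep_var_eq
proof (intro conjI)
  have sub: "subalgebra M G" "subalgebra M H"
    using assms(2,3) indep_setD_ev1[OF assms(1)] indep_setD_ev2[OF assms(1)]
    by (auto simp: subalgebra_def)
  show "random_variable S X" "random_variable T Y"
    using measurable_from_subalg[OF sub(1) assms(4)] measurable_from_subalg[OF sub(2) assms(5)] .
  have "sigma_sets (space M) {X -` A \<inter> space M |A. A \<in> sets S} \<subseteq> sets G"
    using measurable_sets[OF assms(4)] assms(2)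
    by (intro sets.sigma_sets_subset[of _ G, unfolded assms(2)]) auto
  moreover have "sigma_sets (space M) {Y -` A \<inter> space M |A. A \<in> sets T} \<subseteq> sets H"
    using measurable_sets[OF assms(5)] assms(3)
    by (intro sets.sigma_sets_subset[of _ H, unfolded assms(3)]) auto
  ultimately show "indep_set (sigma_sets (space M) {X -` A \<inter> space M |A. A \<in> sets S})
     (sigma_sets (space M) {Y -` A \<inter> space M |A. A \<in> sets T})"
    using assms(1) unfolding indep_sets2_eq by blast
qed

text \<open>The indicator \<open>J\<close> is a function of the increment after \<open>p\<close>,
  hence independent of \<open>g\<close>, and the expectation factorises. Its mean is the probability
  that a Poisson variable is nonzero. This takes the place of a compensator.\<close>

lemma (in prob_space) indep_increment_expectation:
  fixes g :: "'a \<Rightarrow> real" and N :: "'c \<Rightarrow> real \<Rightarrow> 'a \<Rightarrow> nat"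
  assumes N: "independent_poisson_processes M F t0 C r N"
    and F: "space (F p) = space M" and c: "c \<in> C" "0 < r c" and p: "t0 \<le> p" "p < u"
    and g: "g \<in> borel_measurable (F p)" "integrable M g"
  defines "J \<equiv> \<lambda>\<omega>. of_bool (N c u \<omega> - N c p \<omega> \<noteq> 0) :: real"
  shows "integrable M (\<lambda>\<omega>. J \<omega> * g \<omega>)"
    and "expectation (\<lambda>\<omega>. J \<omega> * g \<omega>) = (1 - exp (- (r c * (u - p)))) * expectation g"
proof -
  let ?H = "vimage_algebra (space M) (\<lambda>\<omega>. \<lambda>c\<in>C. N c u \<omega> - N c p \<omega>)
            (PiM C (\<lambda>_. count_space UNIV))"
  have indep: "indep_set (sets (F p)) (sets ?H)"
    using N p unfolding independent_poisson_processes_def by blast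
  have dist: "distr M (count_space UNIV) (\<lambda>\<omega>. N c u \<omega> - N c p \<omega>)
      = measure_pmf (poisson_pmf (r c * (u - p)))"
    using N p c(1) unfolding independent_poisson_processes_def by blast
  have "(\<lambda>\<omega>. \<lambda>c\<in>C. N c u \<omega> - N c p \<omega>) \<in> measurable ?H (PiM C (\<lambda>_. count_space UNIV))"
    by (rule measurable_vimage_algebra1) (auto simp: space_PiM)
  from measurable_compose[OF this measurable_component_singleton[OF c(1)]]
  have inc: "(\<lambda>\<omega>. N c u \<omega> - N c p \<omega>) \<in> measurable ?H (count_space UNIV)"
    using c(1) by simp
  have J: "J \<in> borel_measurable ?H"
    unfolding J_def by (rule measurable_compose[OF inc]) simp
  have sub: "subalgebra M ?H"
    using indep_setD_ev2[OF indep] by (simp add: subalgebra_def)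
  have JM: "J \<in> borel_measurable M" and incM: "(\<lambda>\<omega>. N c u \<omega> - N c p \<omega>) \<in> measurable M (count_space UNIV)"
    using measurable_from_subalg[OF sub J] measurable_from_subalg[OF sub inc] .
  have Jint: "integrable M J"
    by (rule integrable_const_bound[OF _ JM, of 1]) (simp add: J_def)
  have iv: "indep_var borel g borel J"
    using indep_var_of_indep_set[OF indep F _ g(1) J] by simp
  show "integrable M (\<lambda>\<omega>. J \<omega> * g \<omega>)"
    using indep_var_integrable[OF iv g(2) Jint] by (simp add: mult.commute)
  have rate: "0 < r c * (u - p)"
    using c(2) p by simp
  have "expectation J = (\<integral>n. of_bool (n \<noteq> 0) \<partial>distr M (count_space UNIV) (\<lambda>\<omega>. N c u \<omega> - N c p \<omega>))"
    unfolding J_def by (rule integral_distr[OF incM, symmetric]) simp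
  also have "\<dots> = measure_pmf.expectation (poisson_pmf (r c * (u - p))) (indicator (- {0}))"
    unfolding dist by (intro Bochner_Integration.integral_cong) (auto simp: indicator_def)
  also have "\<dots> = 1 - pmf (poisson_pmf (r c * (u - p))) 0"
    using measure_pmf.prob_compl[of "{0}" "poisson_pmf (r c * (u - p))"]
    by (simp add: measure_pmf_single Compl_eq_Diff_UNIV)
  also have "\<dots> = 1 - exp (- (r c * (u - p)))"
    using rate by simp
  finally show "expectation (\<lambda>\<omega>. J \<omega> * g \<omega>) = (1 - exp (- (r c * (u - p)))) * expectation g"
    using indep_var_lebesgue_integral[OF iv g(2) Jint] by (simp add: mult.commute)
qed

section \<open>The Lyapunov function\<close>

definition lyapunov ::
  "('d::finite \<Rightarrow> 'n::finite) \<Rightarrow> real^'d \<Rightarrow> (real^'d) \<times> (real^'d^'n) \<Rightarrow> real" where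
  "lyapunov b y s = (norm (fst s - y))\<^sup>2 + (norm (copy_error b s))\<^sup>2"

section \<open>Equivalence with the squared distance to the reference state\<close>

lemma lyapunov_nonneg: "0 \<le> lyapunov b y s"
  by (simp add: lyapunov_def)

lemma lyapunov_eq_norm:
  "lyapunov b y s = (norm ((\<lambda>s. (fst s, copy_error b s)) (s - reference_state b y)))\<^sup>2"
proof -
  have "copy_error b (s - reference_state b y) = copy_error b s"
    by (simp add: linear_diff[OF linear_copy_error] copy_error_reference_state)
  then show ?thesis
    by (simp add: lyapunov_def norm_Pair reference_state_def)
qed

text \<open>The passage to error coordinates is linear and sends the reference state to the origin,
  so boundedness of linear maps in finite dimension gives the constant.\<close>

lemma lyapunov_upper:
  fixes b :: "'d::finite \<Rightarrow> 'n::finite"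
  obtains B where "0 < B" "\<And>s. lyapunov b y s \<le> B * (norm (s - reference_state b y))\<^sup>2"
proof -
  have "linear (\<lambda>s. (fst s, copy_error b s))"
    by (rule linearI) (simp_all add: linear_add[OF linear_copy_error] linear_scale[OF linear_copy_error])
  from linear_bounded_pos[OF this] obtain B where
    B: "0 < B" "\<And>s. norm ((\<lambda>s. (fst s, copy_error b s)) s) \<le> B * norm s" by blast
  have "lyapunov b y s \<le> B\<^sup>2 * (norm (s - reference_state b y))\<^sup>2" for s
    unfolding lyapunov_eq_norm power_mult_distrib[symmetric] by (intro power_mono B) auto
  with B(1) show ?thesis
    by (intro that[of "B\<^sup>2"]) auto
qed

text \<open>The counterpart of \<open>lyapunov_upper\<close>: the map \<open>T\<close> recovers a
  state from its error coordinates and is again linear, hence bounded.\<close>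

lemma lyapunov_lower:
  fixes b :: "'d::finite \<Rightarrow> 'n::finite"
  obtains B where "0 < B" "\<And>s. (norm (s - reference_state b y))\<^sup>2 \<le> B * lyapunov b y s"
proof -
  define T where "T = (\<lambda>p :: (real^'d) \<times> (real^'d^'n).
    (fst p, \<chi> i. snd p $ i + fst p - subvec b i (fst p)))"
  have "linear T"
    unfolding T_def by (rule linearI) (auto simp: vec_eq_iff subvec_def algebra_simps)
  from linear_bounded_pos[OF this] obtain B where B: "0 < B" "\<And>p. norm (T p) \<le> B * norm p" by blast
  have T: "T (fst s, copy_error b s) = s" for s
    by (cases s) (simp add: T_def copy_error_def vec_eq_iff)
  have "(norm (s - reference_state b y))\<^sup>2 \<le> B\<^sup>2 * lyapunov b y s" for s
    unfolding lyapunov_eq_norm power_mult_distrib[symmetric]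
    using B(2)[of "(\<lambda>s. (fst s, copy_error b s)) (s - reference_state b y)"]
    by (intro power_mono) (simp_all only: T norm_ge_zero)
  with B(1) show ?thesis
    by (intro that[of "B\<^sup>2"]) auto
qed

text \<open>Applies the deterministic step to a solution path, taking for \<open>j\<close> the
  number of channels that fire in \<open>(p, p + h]\<close>.\<close>

lemma flow_lyapunov_step:
  fixes Q :: "real^'d^'d" and b :: "'d::finite \<Rightarrow> 'n::finite"
    and N :: "'n \<times> 'n \<Rightarrow> real \<Rightarrow> nat" and s :: "real \<Rightarrow> (real^'d) \<times> (real^'d^'n)"
  assumes flow: "flow_path b Q q t0 N (\<lambda>t. fst (s t)) (\<lambda>t. snd (s t))"
    and state: "\<And>t. t0 \<le> t \<Longrightarrow> s t \<in> state_space b"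
    and cadlag: "cadlag_from t0 s"
    and counting: "\<And>c. c \<in> channels \<Longrightarrow> counting_path t0 (N c)"
    and y: "Q *v y = - q"
    and L: "0 < L" "\<And>X E. norm (drift Q b X E) \<le> L * (norm X + norm E)"
  defines "K \<equiv> real (CARD('n) * CARD('d))"
  defines "A \<equiv> L * K"
  assumes h: "0 \<le> h" "6 * A * h \<le> 1" and p: "t0 \<le> p"
  shows "lyapunov b y (s (p + h))
      + (\<Sum>i\<in>UNIV. \<Sum>k\<in>UNIV. of_bool (b k \<noteq> i \<and> N (b k, i) (p + h) - N (b k, i) p \<noteq> 0)
          * (copy_error b (s p) $ i $ k)\<^sup>2)
    \<le> lyapunov b y (s p) + h * dissipation Q b (fst (s p) - y) (copy_error b (s p))
      + (K + 1) * (48 * A\<^sup>2 * h\<^sup>2 + 16 * A * h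
          * (\<Sum>c\<in>channels. of_bool (N c (p + h) - N c p \<noteq> 0))) * lyapunov b y (s p)"
proof -
  note path = flow state cadlag counting y
  define X where "X r = fst (s r) - y" for r
  define E where "E r = copy_error b (s r)" for r
  define J where "J k i \<longleftrightarrow> b k \<noteq> i \<and> N (b k, i) (p + h) - N (b k, i) p \<noteq> 0" for k i
  define j where "j = (\<Sum>c\<in>channels. of_bool (N c (p + h) - N c p \<noteq> 0) :: real)"
  have mono: "N (b k, i) r \<le> N (b k, i) r'" if "b k \<noteq> i" "p \<le> r" "r \<le> r'" for i k r r'
    using counting_path_mono[OF counting, of "(b k, i)" r r'] that p by (simp add: channels_def)
  have same: "E r $ i $ k = E p $ i $ k - (X r - X p) $ k"
    if "b k \<noteq> i" "r \<in> {p..p + h}" "N (b k, i) r = N (b k, i) p" for i k r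
    using copy_sample_and_hold(1)[OF path that(1) p _ that(3)] that
    by (simp add: E_def X_def copy_error_component)
  have fresh: "\<exists>\<tau>\<in>{p..r}. E r $ i $ k = (X \<tau> - X r) $ k"
    if "b k \<noteq> i" "r \<in> {p..p + h}" "N (b k, i) r \<noteq> N (b k, i) p" for i k r
    using copy_sample_and_hold(2)[OF path that(1) p _ that(3)] that
    by (simp add: E_def X_def copy_error_component)
  have "(norm (X (p + h)))\<^sup>2 + (norm (E (p + h)))\<^sup>2
      + (\<Sum>i\<in>UNIV. \<Sum>k\<in>UNIV. of_bool (J k i) * (E p $ i $ k)\<^sup>2)
    \<le> (norm (X p))\<^sup>2 + (norm (E p))\<^sup>2 + h * dissipation Q b (X p) (E p)
      + (K + 1) * (48 * A\<^sup>2 * h\<^sup>2 + 16 * A * h * j) * ((norm (X p))\<^sup>2 + (norm (E p))\<^sup>2)"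
    unfolding A_def K_def
  proof (rule one_step_estimate[where L = L and p = p and u = "p + h"])
    show "0 < L" "0 \<le> h" "6 * (L * real (CARD('n) * CARD('d))) * h \<le> 1"
      using L h by (auto simp: A_def K_def)
    show "norm (drift Q b X E) \<le> L * (norm X + norm E)" for X E
      by (rule L)
    show "((\<lambda>\<rho>. - drift Q b (X \<rho>) (E \<rho>)) has_integral (X r - X p)) {p..r}" if "r \<in> {p..p + h}" for r
      using has_integral_increment[OF flow_has_integral_drift[OF path] p, of r] that
      by (simp add: X_def E_def)
    show "continuous_on {p..p + h} X"
      unfolding X_def using p
      by (intro continuous_intros continuous_on_subset[OF continuous_on_flow_fst[OF path]]) auto
    show "E r $ i $ k = 0" if "b k = i" "r \<in> {p..p + h}" for i k r
      using state_space_component[OF state, of r k i] that p by (simp add: E_def copy_error_component)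
    show "E r $ i $ k = E p $ i $ k - (X r - X p) $ k"
      if "b k \<noteq> i" "\<not> J k i" "r \<in> {p..p + h}" for i k r
    proof (rule same)
      \<comment> \<open>The subtraction in \<open>J\<close> is truncated; with monotonicity a zero
        difference at \<open>p + h\<close> forces the count to be constant on the whole
        step.\<close>
      show "N (b k, i) r = N (b k, i) p"
        using that mono[OF that(1), of p r] mono[OF that(1), of r "p + h"] by (simp add: J_def)
    qed (use that in auto)
    show "E r $ i $ k = E p $ i $ k - (X r - X p) $ k \<or> (\<exists>\<tau>\<in>{p..r}. E r $ i $ k = (X \<tau> - X r) $ k)"
      if "b k \<noteq> i" "r \<in> {p..p + h}" for i k r
      using same[OF that] fresh[OF that] by blast
    show "\<exists>\<tau>\<in>{p..p + h}. E (p + h) $ i $ k = (X \<tau> - X (p + h)) $ k" if "b k \<noteq> i" "J k i" for i k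
      using fresh[OF that(1), of "p + h"] that(2) h by (auto simp: J_def)
    show "0 \<le> j"
      by (simp add: j_def sum_nonneg)
    show "1 \<le> j" if "b k \<noteq> i" "J k i" for i k
      using member_le_sum[of "(b k, i)" channels "\<lambda>c. of_bool (N c (p + h) - N c p \<noteq> 0) :: real"] that
      by (simp add: j_def J_def channels_def)
  qed simp
  then show ?thesis
    by (simp add: X_def E_def J_def j_def lyapunov_def)
qed

text \<open>The firing probability has slope \<open>l\<close> at \<open>0\<close>, so it beats every
  smaller slope for short steps. The threshold is where \<open>a * h * (1 + l * h) = l * h\<close>,
  after replacing \<open>exp (l * h)\<close> by its lower bound \<open>1 + l * h\<close>. This is
  how a strict bound on the rates enters.\<close>

lemma eventually_le_one_minus_exp:
  fixes a l :: real
  assumes "0 < a" "a < l"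
  shows "eventually (\<lambda>h. a * h \<le> 1 - exp (- (l * h))) (at_right 0)"
proof -
  have "eventually (\<lambda>h. h < (l - a) / (a * l)) (at_right (0::real))"
    using assms by (intro order_tendstoD(2)[OF tendsto_ident_at]) simp
  then show ?thesis
    using eventually_at_right_less[of 0]
  proof eventually_elim
    case (elim h)
    have "a * l * h \<le> l - a"
      using elim assms by (simp add: field_simps)
    then have "(a * l * h) * h \<le> (l - a) * h"
      using elim by (intro mult_right_mono) auto
    then have "a * h * (1 + l * h) \<le> l * h"
      by (simp add: algebra_simps)
    moreover have "0 < 1 + l * h"
      using elim assms by (simp add: add_pos_pos)
    ultimately have "a * h \<le> 1 - 1 / (1 + l * h)"
      by (simp add: field_simps)
    moreover have "1 / exp (l * h) \<le> 1 / (1 + l * h)"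
      using \<open>0 < 1 + l * h\<close> by (intro divide_left_mono exp_ge_add_one_self) auto
    ultimately show ?case
      by (simp add: exp_minus divide_inverse)
  qed
qed

text \<open>In expectation the refreshed entries pay for \<mu> times the squared copy error, and all
  remainders are of order \<open>h\<^sup>2\<close>, hence absorbed by the gap between \<beta> and
  \<beta>'. The threshold for \<open>h\<close> is uniform in \<open>p\<close>, so that steps can be
  chained.\<close>

lemma (in usual_filtered_prob_space) expected_lyapunov_step:
  fixes Q :: "real^'d^'d" and b :: "'d::finite \<Rightarrow> 'n::finite" and lam :: "'n \<times> 'n \<Rightarrow> real"
    and N :: "'n \<times> 'n \<Rightarrow> real \<Rightarrow> 'a \<Rightarrow> nat"
    and s :: "real \<Rightarrow> 'a \<Rightarrow> (real^'d) \<times> (real^'d^'n)"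
  assumes sym: "transpose Q = Q" and y: "Q *v y = - q"
    and L: "0 < L" "\<And>X E. norm (drift Q b X E) \<le> L * (norm X + norm E)"
    and \<beta>: "0 < \<beta>'" "\<beta> < \<beta>'" "\<beta>' < 2 * lambda_min Q"
  defines "A \<equiv> L * real (CARD('n) * CARD('d))"
  defines "\<mu> \<equiv> \<beta>' + 4 * A\<^sup>2 / (2 * lambda_min Q - \<beta>') + 2 * A"
  assumes lam: "\<And>c. c \<in> channels \<Longrightarrow> \<mu> < lam c"
    and N: "independent_poisson_processes M F t0 channels lam N"
    and s: "flow_solution M F b Q q t0 N s0 s"
  shows "eventually (\<lambda>h. \<forall>p\<ge>t0. integrable M (\<lambda>\<omega>. lyapunov b y (s p \<omega>)) \<longrightarrow>
      integrable M (\<lambda>\<omega>. lyapunov b y (s (p + h) \<omega>)) \<and>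
      expectation (\<lambda>\<omega>. lyapunov b y (s (p + h) \<omega>))
        \<le> exp (- \<beta> * h) * expectation (\<lambda>\<omega>. lyapunov b y (s p \<omega>))) (at_right 0)"
proof -
  define K where "K = real (CARD('n) * CARD('d))"
  define c1 where "c1 = (K + 1) * (48 * A\<^sup>2)"
  define c2 where "c2 = (K + 1) * (16 * A)"
  define \<Lambda> where "\<Lambda> = (\<Sum>c\<in>channels. lam c)"
  have K: "0 \<le> K" and A: "0 < A"
    using L(1) by (auto simp: K_def A_def)
  have c2: "0 \<le> c2"
    using K A by (simp add: c2_def)
  have \<mu>: "0 < \<mu>"
    using \<beta> A by (auto simp: \<mu>_def intro!: add_pos_pos add_pos_nonneg)
  have sub: "subalgebra M (F t)" for t
    by (simp add: subalgebra_def space_F sets_F_subset)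
  \<comment> \<open>Smallness of \<open>h\<close> is used three times: for the displacement bound,
    for firing probabilities of at least \<open>\<mu> * h\<close>, and for the remainder to fit into
    \<open>\<beta>' - \<beta>\<close>.\<close>
  have "eventually (\<lambda>h. h < 1 / (6 * A)) (at_right (0::real))"
    using A by (intro order_tendstoD(2)[OF tendsto_ident_at]) simp
  moreover have "eventually (\<lambda>h. \<forall>c\<in>channels. \<mu> * h \<le> 1 - exp (- (lam c * h))) (at_right 0)"
    using \<mu> lam by (intro eventually_ball_finite ballI eventually_le_one_minus_exp) auto
  moreover have "eventually (\<lambda>h. (c1 + c2 * \<Lambda>) * h < \<beta>' - \<beta>) (at_right (0::real))"
    using \<beta> by (intro order_tendstoD(2)[of _ 0]) (auto intro!: tendsto_eq_intros)
  moreover have "eventually (\<lambda>h. 0 < h) (at_right (0::real))"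
    by (rule eventually_at_right_less)
  ultimately show ?thesis
  proof eventually_elim
    case (elim h)
    then have hA: "6 * A * h \<le> 1"
      using A by (simp add: field_simps)
    show ?case
    proof (intro allI impI)
      fix p assume p: "t0 \<le> p" and int: "integrable M (\<lambda>\<omega>. lyapunov b y (s p \<omega>))"
      define V where "V \<omega> = lyapunov b y (s p \<omega>)" for \<omega>
      define U where "U \<omega> = lyapunov b y (s (p + h) \<omega>)" for \<omega>
      define e where "e i k \<omega> = (copy_error b (s p \<omega>) $ i $ k)\<^sup>2" for i k \<omega>
      define J where "J c \<omega> = (of_bool (N c (p + h) \<omega> - N c p \<omega> \<noteq> 0) :: real)" for c \<omega>
      have V: "integrable M V" "\<And>\<omega>. 0 \<le> V \<omega>"
        using int by (simp_all add: V_def[abs_def] lyapunov_nonneg)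
      have sF: "s t \<in> borel_measurable (F t)" if "t0 \<le> t" for t
        using s that by (simp add: flow_solution_def)
      have ce: "continuous_on UNIV (copy_error b)"
        using linear_copy_error by (rule linear_continuous_on[OF linear_conv_bounded_linear[THEN iffD1]])
      have lyF: "(\<lambda>\<omega>. lyapunov b y (s t \<omega>)) \<in> borel_measurable (F t)" if "t0 \<le> t" for t
      proof (rule borel_measurable_continuous_on[OF _ sF[OF that]])
        show "continuous_on UNIV (lyapunov b y)"
          unfolding lyapunov_def[abs_def] by (intro continuous_intros ce)
      qed
      have eF: "e i k \<in> borel_measurable (F p)" for i k
        unfolding e_def[abs_def]
      proof (rule borel_measurable_continuous_on[OF _ sF[OF p]])
        show "continuous_on UNIV (\<lambda>s. (copy_error b s $ i $ k)\<^sup>2)"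
          by (intro continuous_intros ce)
      qed
      have VF: "V \<in> borel_measurable (F p)"
        using lyF[OF p] by (simp add: V_def[abs_def])
      have UM: "U \<in> borel_measurable M"
        using measurable_from_subalg[OF sub lyF[of "p + h"]] p elim by (simp add: U_def[abs_def])
      have e_le: "e i k \<omega> \<le> V \<omega>" for i k \<omega>
      proof -
        have "e i k \<omega> \<le> (norm (copy_error b (s p \<omega>)))\<^sup>2"
          unfolding e_def using entry_le_norm[of "copy_error b (s p \<omega>)" i k]
          by (simp add: abs_le_square_iff[symmetric])
        then show ?thesis
          by (simp add: V_def lyapunov_def add_increasing)
      qed
      have e: "integrable M (e i k)" for i k
        using e_le[of i k] V(2)
        by (intro Bochner_Integration.integrable_bound[OF V(1) measurable_from_subalg[OF sub eF]] AE_I2)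
          (simp add: e_def)
      have p': "p < p + h"
        using elim by simp
      have lam0: "0 < lam c" if "c \<in> channels" for c
        using lam[OF that] \<mu> by simp
      note step = indep_increment_expectation[OF N space_F _ lam0 p p', folded J_def]
      have JV: "integrable M (\<lambda>\<omega>. J c \<omega> * V \<omega>)"
          "expectation (\<lambda>\<omega>. J c \<omega> * V \<omega>) = (1 - exp (- (lam c * h))) * expectation V"
        if "c \<in> channels" for c
        using step[OF that that VF V(1)] by simp_all
      have Je: "integrable M (\<lambda>\<omega>. J c \<omega> * e i k \<omega>)"
          "expectation (\<lambda>\<omega>. J c \<omega> * e i k \<omega>) = (1 - exp (- (lam c * h))) * expectation (e i k)"
        if "c \<in> channels" for c i k
        using step[OF that that eF e] by simp_all
      \<comment> \<open>The squared errors wiped out by communication. The first factor removes own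
        entries, to which no channel belongs.\<close>
      define W where "W i k \<omega> = of_bool (b k \<noteq> i) * (J (b k, i) \<omega> * e i k \<omega>)" for i k \<omega>
      have W: "integrable M (W i k)" for i k
        by (cases "b k = i") (auto simp: W_def[abs_def] channels_def intro!: Je)
      have path: "AE \<omega> in M. U \<omega> + (\<Sum>i\<in>UNIV. \<Sum>k\<in>UNIV. W i k \<omega>)
          \<le> (1 - \<beta>' * h + c1 * h\<^sup>2) * V \<omega> + h * \<mu> * (\<Sum>i\<in>UNIV. \<Sum>k\<in>UNIV. e i k \<omega>)
            + c2 * h * (\<Sum>c\<in>channels. J c \<omega> * V \<omega>)"
        and own: "AE \<omega> in M. \<forall>i k. b k = i \<longrightarrow> e i k \<omega> = 0"
      proof -
        have "AE \<omega> in M. \<forall>c\<in>channels. counting_path t0 (\<lambda>t. N c t \<omega>)"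
          using N by (intro AE_finite_allI) (auto simp: independent_poisson_processes_def)
        moreover have "AE \<omega> in M. s t0 \<omega> = s0 \<and> (\<forall>t\<ge>t0. s t \<omega> \<in> state_space b) \<and>
            cadlag_from t0 (\<lambda>t. s t \<omega>) \<and>
            flow_path b Q q t0 (\<lambda>c t. N c t \<omega>) (\<lambda>t. fst (s t \<omega>)) (\<lambda>t. snd (s t \<omega>))"
          using s by (simp add: flow_solution_def)
        ultimately show "AE \<omega> in M. U \<omega> + (\<Sum>i\<in>UNIV. \<Sum>k\<in>UNIV. W i k \<omega>)
          \<le> (1 - \<beta>' * h + c1 * h\<^sup>2) * V \<omega> + h * \<mu> * (\<Sum>i\<in>UNIV. \<Sum>k\<in>UNIV. e i k \<omega>)
            + c2 * h * (\<Sum>c\<in>channels. J c \<omega> * V \<omega>)"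
        proof eventually_elim
          case (elim \<omega>)
          define j where "j = (\<Sum>c\<in>channels. J c \<omega>)"
          have W_eq: "W i k \<omega> = of_bool (b k \<noteq> i \<and> N (b k, i) (p + h) \<omega> - N (b k, i) p \<omega> \<noteq> 0)
              * (copy_error b (s p \<omega>) $ i $ k)\<^sup>2" for i k
            by (simp add: W_def J_def e_def)
          have e_eq: "(\<Sum>i\<in>UNIV. \<Sum>k\<in>UNIV. e i k \<omega>) = (norm (copy_error b (s p \<omega>)))\<^sup>2"
            by (simp add: e_def norm_matrix_squared)
          have "U \<omega> + (\<Sum>i\<in>UNIV. \<Sum>k\<in>UNIV. W i k \<omega>)
            \<le> V \<omega> + h * dissipation Q b (fst (s p \<omega>) - y) (copy_error b (s p \<omega>))
              + (K + 1) * (48 * A\<^sup>2 * h\<^sup>2 + 16 * A * h * j) * V \<omega>"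
            unfolding U_def V_def W_eq j_def J_def A_def K_def
            by (rule flow_lyapunov_step[where s = "\<lambda>t. s t \<omega>" and N = "\<lambda>c t. N c t \<omega>"
                  and ?t0.0 = t0 and q = q])
              (use elim y L p hA \<open>0 < h\<close> in \<open>auto simp: A_def\<close>)
          also have "h * dissipation Q b (fst (s p \<omega>) - y) (copy_error b (s p \<omega>))
              \<le> h * (- \<beta>' * V \<omega> + \<mu> * (norm (copy_error b (s p \<omega>)))\<^sup>2)"
            unfolding V_def lyapunov_def \<mu>_def A_def
            using dissipation_bound[OF sym L \<beta>(3)] \<open>0 < h\<close> by (intro mult_left_mono) auto
          finally show ?case
            unfolding e_eq sum_distrib_right[symmetric] j_def[symmetric] c1_def c2_def
            by (simp add: algebra_simps)
        qed
        show "AE \<omega> in M. \<forall>i k. b k = i \<longrightarrow> e i k \<omega> = 0"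
          using \<open>AE \<omega> in M. s t0 \<omega> = s0 \<and> _\<close>
        proof eventually_elim
          case (elim \<omega>)
          then show ?case
            using p by (auto simp: e_def copy_error_component state_space_component)
        qed
      qed
      define rhs where "rhs \<omega> = (1 - \<beta>' * h + c1 * h\<^sup>2) * V \<omega>
        + h * \<mu> * (\<Sum>i\<in>UNIV. \<Sum>k\<in>UNIV. e i k \<omega>) + c2 * h * (\<Sum>c\<in>channels. J c \<omega> * V \<omega>)" for \<omega>
      have rhs: "integrable M rhs"
        unfolding rhs_def[abs_def] using V(1) e JV(1) by auto
      have W0: "0 \<le> (\<Sum>i\<in>UNIV. \<Sum>k\<in>UNIV. W i k \<omega>)" for \<omega>
        by (intro sum_nonneg) (simp add: W_def J_def e_def)
      \<comment> \<open>Since \<open>W\<close> is nonnegative, the path inequality dominates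
        \<open>U\<close> by an integrable function; finiteness of the mean is thus passed on to the
        next time point.\<close>
      have U: "integrable M U"
      proof (rule Bochner_Integration.integrable_bound[OF rhs UM])
        show "AE \<omega> in M. norm (U \<omega>) \<le> norm (rhs \<omega>)"
          using path
        proof eventually_elim
          case (elim \<omega>)
          then show ?case
            using W0[of \<omega>] lyapunov_nonneg[of b y "s (p + h) \<omega>"] unfolding rhs_def[symmetric]
            by (simp add: U_def)
        qed
      qed
      have "expectation (\<lambda>\<omega>. U \<omega> + (\<Sum>i\<in>UNIV. \<Sum>k\<in>UNIV. W i k \<omega>)) \<le> expectation rhs"
        using path U W rhs by (intro integral_mono_AE) (auto simp: rhs_def)
      then have main: "expectation U + (\<Sum>i\<in>UNIV. \<Sum>k\<in>UNIV. expectation (W i k))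
          \<le> (1 - \<beta>' * h + c1 * h\<^sup>2) * expectation V
            + h * \<mu> * (\<Sum>i\<in>UNIV. \<Sum>k\<in>UNIV. expectation (e i k))
            + c2 * h * (\<Sum>c\<in>channels. (1 - exp (- (lam c * h))) * expectation V)"
        using U W V(1) e JV by (simp add: rhs_def[abs_def])
      \<comment> \<open>This cancels the \<mu> term of the drift entry by entry. Own entries are
        almost surely zero; for the others the firing probability is at least
        \<open>\<mu> * h\<close>.\<close>
      have "h * \<mu> * expectation (e i k) \<le> expectation (W i k)" for i k
      proof (cases "b k = i")
        case True
        have "expectation (e i k) = 0"
          by (intro integral_eq_zero_AE eventually_mono[OF own]) (use True in blast)
        then show ?thesis
          by (simp add: W_def[abs_def] True)
      next
        case False
        then have ch: "(b k, i) \<in> channels"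
          by (simp add: channels_def)
        have "h * \<mu> * expectation (e i k) \<le> (1 - exp (- (lam (b k, i) * h))) * expectation (e i k)"
          using elim ch by (intro mult_right_mono Bochner_Integration.integral_nonneg) (auto simp: e_def mult.commute)
        then show ?thesis
          using Je(2)[OF ch] by (simp add: W_def[abs_def] False)
      qed
      then have "h * \<mu> * (\<Sum>i\<in>UNIV. \<Sum>k\<in>UNIV. expectation (e i k))
          \<le> (\<Sum>i\<in>UNIV. \<Sum>k\<in>UNIV. expectation (W i k))"
        unfolding sum_distrib_left by (intro sum_mono)
      moreover have EV: "0 \<le> expectation V"
        using V(2) by (intro Bochner_Integration.integral_nonneg) auto
      \<comment> \<open>A firing probability is at most \<open>lam c * h\<close>; together with the
        factor \<open>h\<close> in front, the penalty for jumps becomes second order.\<close>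
      have "(\<Sum>c\<in>channels. (1 - exp (- (lam c * h))) * expectation V)
          \<le> (\<Sum>c\<in>channels. (lam c * h) * expectation V)"
        using EV exp_ge_add_one_self[of "- (lam _ * h)"] by (intro sum_mono mult_right_mono) (auto simp: algebra_simps)
      then have "c2 * h * (\<Sum>c\<in>channels. (1 - exp (- (lam c * h))) * expectation V)
          \<le> c2 * h * (\<Lambda> * h * expectation V)"
        using c2 elim by (intro mult_left_mono) (auto simp: \<Lambda>_def sum_distrib_right)
      ultimately have "expectation U
          \<le> (1 - \<beta>' * h + c1 * h\<^sup>2) * expectation V + c2 * h * (\<Lambda> * h * expectation V)"
        using main by linarith
      also have "\<dots> = (1 + h * ((c1 + c2 * \<Lambda>) * h - \<beta>')) * expectation V"
        by (simp add: algebra_simps power2_eq_square)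
      also have "\<dots> \<le> (1 + h * (- \<beta>)) * expectation V"
        using elim EV by (intro mult_right_mono add_left_mono mult_left_mono) auto
      also have "\<dots> \<le> exp (- \<beta> * h) * expectation V"
        using exp_ge_add_one_self[of "- \<beta> * h"] EV by (intro mult_right_mono) (auto simp: mult.commute)
      finally show "integrable M (\<lambda>\<omega>. lyapunov b y (s (p + h) \<omega>)) \<and>
          expectation (\<lambda>\<omega>. lyapunov b y (s (p + h) \<omega>))
            \<le> exp (- \<beta> * h) * expectation (\<lambda>\<omega>. lyapunov b y (s p \<omega>))"
        using U by (simp add: U_def[abs_def] V_def[abs_def])
    qed
  qed
qed

section \<open>Exponential decay\<close>

text \<open>Splits the time interval into equal steps below the threshold and multiplies the
  contraction factors. Integrability starts from the deterministic initial state and is carried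
  along in the induction.\<close>

lemma (in usual_filtered_prob_space) expected_lyapunov_decay:
  fixes Q :: "real^'d^'d" and b :: "'d::finite \<Rightarrow> 'n::finite" and lam :: "'n \<times> 'n \<Rightarrow> real"
    and N :: "'n \<times> 'n \<Rightarrow> real \<Rightarrow> 'a \<Rightarrow> nat"
    and s :: "real \<Rightarrow> 'a \<Rightarrow> (real^'d) \<times> (real^'d^'n)"
  assumes sym: "transpose Q = Q" and y: "Q *v y = - q"
    and L: "0 < L" "\<And>X E. norm (drift Q b X E) \<le> L * (norm X + norm E)"
    and \<beta>: "0 < \<beta>'" "\<beta> < \<beta>'" "\<beta>' < 2 * lambda_min Q"
  defines "A \<equiv> L * real (CARD('n) * CARD('d))"
  assumes lam: "\<And>c. c \<in> channels \<Longrightarrow> \<beta>' + 4 * A\<^sup>2 / (2 * lambda_min Q - \<beta>') + 2 * A < lam c"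
    and N: "independent_poisson_processes M F t0 channels lam N"
    and s: "flow_solution M F b Q q t0 N s0 s"
    and t: "t0 \<le> t"
  shows "integrable M (\<lambda>\<omega>. lyapunov b y (s t \<omega>)) \<and>
    expectation (\<lambda>\<omega>. lyapunov b y (s t \<omega>)) \<le> exp (- \<beta> * (t - t0)) * lyapunov b y s0"
proof -
  define V where "V r \<omega> = lyapunov b y (s r \<omega>)" for r \<omega>
  have init: "AE \<omega> in M. V t0 \<omega> = lyapunov b y s0"
    using s unfolding flow_solution_def V_def by (auto elim: eventually_mono)
  have V: "V r \<in> borel_measurable M" if "t0 \<le> r" for r
    unfolding V_def[abs_def]
  proof (rule borel_measurable_continuous_on[where f = "lyapunov b y"])
    show "continuous_on UNIV (lyapunov b y)"
      unfolding lyapunov_def[abs_def]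
      by (intro continuous_intros linear_continuous_on[OF linear_conv_bounded_linear[THEN iffD1]]
          linear_copy_error)
    have "subalgebra M (F r)"
      by (simp add: subalgebra_def space_F sets_F_subset)
    then show "s r \<in> borel_measurable M"
      using s that by (auto simp: flow_solution_def intro: measurable_from_subalg)
  qed
  have "integrable M (V t0) \<longleftrightarrow> integrable M (\<lambda>\<omega>. lyapunov b y s0)"
    using init V by (intro integrable_cong_AE) auto
  then have start_int: "integrable M (V t0)"
    by simp
  have "expectation (V t0) = expectation (\<lambda>\<omega>. lyapunov b y s0)"
    using init V by (intro integral_cong_AE) auto
  then have start: "expectation (V t0) = lyapunov b y s0"
    by (simp add: prob_space)
  show ?thesis
  proof (cases "t = t0")
    case True
    then show ?thesis
      using start_int start by (simp add: V_def[abs_def])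
  next
    case False
    with t have t: "t0 < t" by simp
    obtain h0 where h0: "0 < h0" and step: "\<And>h p. 0 < h \<Longrightarrow> h < h0 \<Longrightarrow> t0 \<le> p \<Longrightarrow> integrable M (V p) \<Longrightarrow>
        integrable M (V (p + h)) \<and> expectation (V (p + h)) \<le> exp (- \<beta> * h) * expectation (V p)"
      using expected_lyapunov_step[OF sym y L \<beta> lam[unfolded A_def] N s]
      by (auto simp: eventually_at_right_field V_def[abs_def])
    \<comment> \<open>The number of steps is chosen so that \<open>n\<close> equal steps end exactly
      at \<open>t\<close> with length below \<open>h0\<close>.\<close>
    obtain n :: nat where n: "(t - t0) / h0 < real n"
      using reals_Archimedean2 by blast
    then have "0 < real n"
      using t h0 by (meson divide_pos_pos diff_gt_0_iff_gt less_trans)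
    define h where "h = (t - t0) / real n"
    have h: "0 < h" "h < h0"
      using n t h0 \<open>0 < real n\<close> by (auto simp: h_def field_simps)
    have iter: "integrable M (V (t0 + real m * h)) \<and>
        expectation (V (t0 + real m * h)) \<le> exp (- \<beta> * (real m * h)) * lyapunov b y s0" for m
    proof (induction m)
      case 0
      then show ?case
        using start start_int by simp
    next
      case (Suc m)
      have eq: "t0 + real (Suc m) * h = t0 + real m * h + h"
        by (simp add: algebra_simps)
      have one: "integrable M (V (t0 + real (Suc m) * h))"
          "expectation (V (t0 + real (Suc m) * h)) \<le> exp (- \<beta> * h) * expectation (V (t0 + real m * h))"
        using step[OF h, of "t0 + real m * h"] Suc h unfolding eq by auto
      note one(2)
      also have "exp (- \<beta> * h) * expectation (V (t0 + real m * h))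
          \<le> exp (- \<beta> * h) * (exp (- \<beta> * (real m * h)) * lyapunov b y s0)"
        using Suc by (intro mult_left_mono) auto
      also have "\<dots> = exp (- \<beta> * (real (Suc m) * h)) * lyapunov b y s0"
      proof -
        have "- \<beta> * (real (Suc m) * h) = - \<beta> * h + - \<beta> * (real m * h)"
          by (simp add: algebra_simps)
        then show ?thesis
          by (simp only: exp_add mult.assoc)
      qed
      finally show ?case
        using one(1) by blast
    qed
    have "t0 + real n * h = t" "real n * h = t - t0"
      using \<open>0 < real n\<close> by (simp_all add: h_def)
    then show ?thesis
      using iter[of n] by (simp add: V_def[abs_def])
  qed
qed

text \<open>Translates the decay of \<open>lyapunov\<close> back to the Euclidean distance. The
  constant \<open>B2 * B1\<close> comes from the equivalence of the two and is the same for all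
  initial states and solutions.\<close>

lemma flow_ms_exp_stable_with_rate:
  fixes Q :: "real^'d^'d" and b :: "'d::finite \<Rightarrow> 'n::finite" and lam :: "'n \<times> 'n \<Rightarrow> real"
    and N :: "'n \<times> 'n \<Rightarrow> real \<Rightarrow> 'a \<Rightarrow> nat"
  assumes sym: "transpose Q = Q" and y: "Q *v y = - q"
    and L: "0 < L" "\<And>X E. norm (drift Q b X E) \<le> L * (norm X + norm E)"
    and \<beta>: "0 < \<beta>'" "\<beta> < \<beta>'" "\<beta>' < 2 * lambda_min Q"
  defines "A \<equiv> L * real (CARD('n) * CARD('d))"
  assumes lam: "\<And>c. c \<in> channels \<Longrightarrow> \<beta>' + 4 * A\<^sup>2 / (2 * lambda_min Q - \<beta>') + 2 * A < lam c"
    and M: "usual_filtered_prob_space M F"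
    and N: "independent_poisson_processes M F t0 channels lam N"
  shows "ms_exp_stable_with_rate M t0 (flow_solution M F b Q q t0 N) (reference_state b y) \<beta>"
proof -
  interpret usual_filtered_prob_space M F by (rule M)
  obtain B1 where B1: "0 < B1" "\<And>s. lyapunov b y s \<le> B1 * (norm (s - reference_state b y))\<^sup>2"
    by (rule lyapunov_upper[of b y]) blast
  obtain B2 where B2: "0 < B2" "\<And>s. (norm (s - reference_state b y))\<^sup>2 \<le> B2 * lyapunov b y s"
    by (rule lyapunov_lower[of b y]) blast
  show ?thesis
    unfolding ms_exp_stable_with_rate_def
  proof (intro exI conjI allI impI)
    show "0 < B2 * B1"
      using B1 B2 by simp
    fix s0 s t
    assume s: "flow_solution M F b Q q t0 N s0 s" and t: "t0 \<le> t"
    note decay = expected_lyapunov_decay[OF sym y L \<beta> lam[unfolded A_def] N s t]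
    have "(\<integral>\<^sup>+\<omega>. ennreal ((norm (s t \<omega> - reference_state b y))\<^sup>2) \<partial>M)
        \<le> (\<integral>\<^sup>+\<omega>. ennreal (B2 * lyapunov b y (s t \<omega>)) \<partial>M)"
      by (intro nn_integral_mono ennreal_leI B2)
    also have "\<dots> = ennreal (expectation (\<lambda>\<omega>. B2 * lyapunov b y (s t \<omega>)))"
      using decay B2(1) by (intro nn_integral_eq_integral) (auto simp: lyapunov_nonneg)
    also have "\<dots> \<le> ennreal (B2 * B1 * (norm (s0 - reference_state b y))\<^sup>2 * exp (- \<beta> * (t - t0)))"
    proof (rule ennreal_leI)
      have "expectation (\<lambda>\<omega>. B2 * lyapunov b y (s t \<omega>))
          \<le> B2 * (exp (- \<beta> * (t - t0)) * lyapunov b y s0)"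
        using decay B2(1) by (simp add: mult_left_mono)
      also have "\<dots> \<le> B2 * (exp (- \<beta> * (t - t0)) * (B1 * (norm (s0 - reference_state b y))\<^sup>2))"
        using B1 B2(1) by (intro mult_left_mono) auto
      finally show "expectation (\<lambda>\<omega>. B2 * lyapunov b y (s t \<omega>))
          \<le> B2 * B1 * (norm (s0 - reference_state b y))\<^sup>2 * exp (- \<beta> * (t - t0))"
        by (simp add: mult_ac)
    qed
    finally show "(\<integral>\<^sup>+\<omega>. ennreal ((norm (s t \<omega> - reference_state b y))\<^sup>2) \<partial>M)
        \<le> ennreal (B2 * B1 * (norm (s0 - reference_state b y))\<^sup>2 * exp (- \<beta> * (t - t0)))" .
  qed
qed

theorem corollary1:
  fixes Q :: "real^'d^'d"
    and q ystar :: "real^'d"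
    and b :: "'d::finite \<Rightarrow> 'n::finite"
    and t0 :: real
  assumes "transpose Q = Q"
    and "positive_definite Q"
    and "ystar = - (matrix_inv Q *v q)"
  shows
    "\<exists>lam_s\<ge>0.
       (\<forall>lam :: 'n \<times> 'n \<Rightarrow> real. (\<forall>c\<in>channels. lam_s < lam c) \<longrightarrow>
          (\<forall>(M :: 'a measure) F N.
             usual_filtered_prob_space M F \<longrightarrow>
             independent_poisson_processes M F t0 channels lam N \<longrightarrow>
             ms_exp_stable M t0 (flow_solution M F b Q q t0 N) (reference_state b ystar))) \<and>
       (\<forall>\<beta>. 0 < \<beta> \<and> \<beta> < 2 * lambda_min Q \<longrightarrow>
          (\<exists>lam_d\<ge>lam_s.
             \<forall>lam :: 'n \<times> 'n \<Rightarrow> real. (\<forall>c\<in>channels. lam_d < lam c) \<longrightarrow>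
               (\<forall>(M :: 'a measure) F N.
                  usual_filtered_prob_space M F \<longrightarrow>
                  independent_poisson_processes M F t0 channels lam N \<longrightarrow>
                  ms_exp_stable_with_rate M t0 (flow_solution M F b Q q t0 N)
                    (reference_state b ystar) \<beta>)))"
proof -
  obtain L where L: "0 < L" "\<And>X E. norm (drift Q b X E) \<le> L * (norm X + norm E)"
    using drift_bound[of Q b] by blast
  define A where "A = L * real (CARD('n) * CARD('d))"
  \<comment> \<open>The rate threshold for an intermediate decay rate. It depends on
    \<open>Q\<close> and the partition only, so it can be fixed before the probability space and the
    channel rates.\<close>
  define \<mu> where "\<mu> \<beta> = \<beta> + 4 * A\<^sup>2 / (2 * lambda_min Q - \<beta>) + 2 * A" for \<beta>
  have y: "Q *v ystar = - q"
    using positive_definite_minimiser[OF assms(2)] assms(3) by simp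
  have pos: "0 < lambda_min Q"
    by (rule lambda_min_pos[OF assms(1,2)])
  have stable: "ms_exp_stable_with_rate M t0 (flow_solution M F b Q q t0 N) (reference_state b ystar) \<beta>"
    if "0 < \<beta>'" "\<beta> < \<beta>'" "\<beta>' < 2 * lambda_min Q" "\<forall>c\<in>channels. \<mu> \<beta>' < lam c"
      "usual_filtered_prob_space M F" "independent_poisson_processes M F t0 channels lam N"
    for M :: "'a measure" and F N \<beta> \<beta>' and lam :: "'n \<times> 'n \<Rightarrow> real"
    using flow_ms_exp_stable_with_rate[OF assms(1) y L that(1,2,3) _ that(5,6)] that(4)
    by (simp add: \<mu>_def A_def)
  \<comment> \<open>For part (a) the intermediate rate is the midpoint of
    \<open>(0, 2 * lambda_min Q)\<close>; half of it then serves as convergence rate.\<close>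
  define lam_s where "lam_s = \<mu> (lambda_min Q)"
  show ?thesis
  proof (rule exI[of _ lam_s], intro conjI allI impI)
    show "0 \<le> lam_s"
      using pos L(1) by (auto simp: lam_s_def \<mu>_def A_def intro!: add_nonneg_nonneg)
  next
    fix lam :: "'n \<times> 'n \<Rightarrow> real" and M :: "'a measure" and F N
    assume "\<forall>c\<in>channels. lam_s < lam c" "usual_filtered_prob_space M F"
      "independent_poisson_processes M F t0 channels lam N"
    then show "ms_exp_stable M t0 (flow_solution M F b Q q t0 N) (reference_state b ystar)"
      unfolding ms_exp_stable_def using pos
      by (intro exI[of _ "lambda_min Q / 2"] conjI stable[of "lambda_min Q"])
        (auto simp: lam_s_def)
  next
    fix \<beta>
    assume \<beta>: "0 < \<beta> \<and> \<beta> < 2 * lambda_min Q"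
    \<comment> \<open>The midpoint leaves room on both sides: towards \<beta> for the discretisation
      remainder, towards \<open>2 * lambda_min Q\<close> for the cross terms.\<close>
    define \<beta>' where "\<beta>' = (\<beta> + 2 * lambda_min Q) / 2"
    have \<beta>': "0 < \<beta>'" "\<beta> < \<beta>'" "\<beta>' < 2 * lambda_min Q"
      using \<beta> by (auto simp: \<beta>'_def)
    show "\<exists>lam_d\<ge>lam_s. \<forall>lam :: 'n \<times> 'n \<Rightarrow> real. (\<forall>c\<in>channels. lam_d < lam c) \<longrightarrow>
       (\<forall>(M :: 'a measure) F N. usual_filtered_prob_space M F \<longrightarrow>
          independent_poisson_processes M F t0 channels lam N \<longrightarrow>
          ms_exp_stable_with_rate M t0 (flow_solution M F b Q q t0 N) (reference_state b ystar) \<beta>)"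
      \<comment> \<open>The maximum secures the required order between the two thresholds.\<close>
      by (intro exI[of _ "max lam_s (\<mu> \<beta>')"] conjI allI impI stable[OF \<beta>']) auto
  qed
qed

end
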